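(* The number $M'(n,2)$ of 2-ball multiplex prime juggling patterns of period $n$ satisfies $M'(n,2)\sim\gamma_{M'}2^n$ as $n\to\infty$, where $\gamma_{M'}=\sum_{t=1}^\infty(t+1)q_t$.
   Context: A 2-ball multiplex state is a sequence $\alpha=(\alpha_1,\alpha_2,\dots)$ with $\alpha_i\in\{0,1,2\}$, finitely many nonzero, $\sum_i\alpha_i=2$. There is a transition $\alpha\to\beta$ iff $\alpha_{i+1}\le\beta_i$ for all $i\ge1$. A 2-ball multiplex prime juggling pattern of period $n$ is a directed cycle of length $n$ in this state graph, counted up to cyclic rotation. The sequence $q_t$ is $q_t=\frac12\prod_{i=2}^t\frac{i-1}{2^i-i-1}$ (so $q_1=1/2$). *)

theory Defs
  imports
    Complex_Main
    "HOL-Library.Landau_Symbols"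
    "Graph_Theory.Graph_Theory"
begin

text \<open>States are indexed from 0: \<open>\<alpha> i\<close> is the multiplicity at height \<open>i + 1\<close>, so that no unused
  entry at index 0 can distinguish two equal states.\<close>

definition multiplex_states :: "(nat \<Rightarrow> nat) set" where
  "multiplex_states =
     {\<alpha>. (\<forall>i. \<alpha> i \<in> {0, 1, 2}) \<and> finite {i. \<alpha> i \<noteq> 0} \<and> (\<Sum>i | \<alpha> i \<noteq> 0. \<alpha> i) = 2}"

definition multiplex_state_graph :: "(nat \<Rightarrow> nat) pair_pre_digraph" where
  "multiplex_state_graph =
     \<lparr> pverts = multiplex_states,
       parcs = {(\<alpha>, \<beta>). \<alpha> \<in> multiplex_states \<and> \<beta> \<in> multiplex_states \<and>
                        (\<forall>i. \<alpha> (Suc i) \<le> \<beta> i)} \<rparr>"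

text \<open>A \<^const>\<open>pre_digraph.cycle\<close> is a nonempty closed walk, given by its list of arcs, that visits
  no vertex twice; loops are cycles of length 1.\<close>

definition multiplex_cycles :: "nat \<Rightarrow> ((nat \<Rightarrow> nat) \<times> (nat \<Rightarrow> nat)) list set" where
  "multiplex_cycles n =
     {p. pre_digraph.cycle (with_proj multiplex_state_graph) p \<and> length p = n}"

definition rotation_rel :: "'a list set \<Rightarrow> ('a list \<times> 'a list) set" where
  "rotation_rel A = {(p, p'). p \<in> A \<and> p' \<in> A \<and> (\<exists>k. p' = rotate k p)}"

definition multiplex_prime_patterns ::
    "nat \<Rightarrow> ((nat \<Rightarrow> nat) \<times> (nat \<Rightarrow> nat)) list set set" where
  "multiplex_prime_patterns n = multiplex_cycles n // rotation_rel (multiplex_cycles n)"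

text \<open>The state graph is infinite, but the set counted here is finite: if a state on a cycle of
  length \<open>n\<close> has a ball at height \<open>h > n\<close>, it also has one at height \<open>h - n\<close>, so with two balls
  all heights are at most \<open>2 * n\<close>, and \<^const>\<open>card\<close> is the true count.\<close>

definition num_multiplex_primes :: "nat \<Rightarrow> nat" where
  "num_multiplex_primes n = card (multiplex_prime_patterns n)"

definition q_seq :: "nat \<Rightarrow> real" where
  "q_seq t = 1 / 2 * (\<Prod>i = 2..t. (real i - 1) / (2 ^ i - real i - 1))"

text \<open>\<^const>\<open>suminf\<close> starts at 0, hence the shift from \<open>t\<close> to \<open>Suc t\<close>.\<close>

definition gamma_M :: real where
  "gamma_M = (\<Sum>t. (real (Suc t) + 1) * q_seq (Suc t))"

end

theory Submission
  imports Defs "HOL-Library.Disjoint_Sets" "HOL-Combinatorics.Multiset_Permutations"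
    "HOL-Analysis.Uniform_Limit"
begin

text \<open>Let a state with its lower ball about to be thrown and the other ball \<open>d\<close> steps above it be the
  key \<open>d\<close>. Every other state has a single successor, so a cycle is determined by its keys
  together with the throws made from them. From a key \<open>d > 0\<close> the thrown ball lands above the other
  one, or below it, at a position that makes some \<open>e < d\<close> the next key. Cutting the
  key sequence at the throws above splits the cycle into decreasing runs of keys, and the time spent on a
  run is its maximum. A cycle is therefore an arrangement of pairwise disjoint nonempty finite sets of
  positive integers, linear if the key 0 is visited (from where any delay is possible) and cyclic
  otherwise. If \<open>W\<^sub>t(n)\<close> is the number of families of \<open>t\<close> such sets with maxima summing to \<open>n\<close>, then
  \<open>M'(n,2) = \<Sum>\<^sub>t t! (\<Sum>\<^sub>m\<^sub><\<^sub>n W\<^sub>t(m)) + \<Sum>\<^sub>t (t-1)! W\<^sub>t(n)\<close>. Lowering all elements by 1 gives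
  \<open>W\<^sub>t(n+t) = (t+1) W\<^sub>t(n) + W\<^sub>t\<^sub>-\<^sub>1(n)\<close>, so that \<open>W\<^sub>t(n)/2\<^sup>n\<close> tends to \<open>q\<^sub>t/(t-1)!\<close> and never exceeds it,
  and Tannery's theorem yields the limit of the sum.\<close>

section \<open>States and rotation classes of cycles\<close>

text \<open>The pair \<open>(k, e)\<close> stands for balls at the indices \<open>k\<close> and \<open>k + e\<close>; it is a key if \<open>k = 0\<close>.\<close>

definition state_of :: "nat \<times> nat \<Rightarrow> nat \<Rightarrow> nat" where
  "state_of s i = of_bool (i = fst s) + of_bool (i = fst s + snd s)"

text \<open>The clauses follow the number of balls at index 0. In the last one the other ball falls
  to index \<open>d\<close>, and the two alternatives say that the thrown ball lands at or above it
  (\<open>k = d\<close>) or at or below it (\<open>k + e = d\<close>).\<close>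

fun step :: "nat \<times> nat \<Rightarrow> nat \<times> nat \<Rightarrow> bool" where
  "step (Suc k, e) s = (s = (k, e))"
| "step (0, 0) s = True"
| "step (0, Suc d) (k, e) = (k = d \<or> k + e = d)"

text \<open>Both states carry two balls, so pointwise domination leaves no slack. The case
  \<open>e = 0\<close> is treated separately because two balls then share one index.\<close>

lemma state_of_le_imp_eq:
  assumes "\<And>i. state_of s i \<le> state_of s' i"
  shows "s = s'"
proof -
  obtain k e k' e' where s: "s = (k, e)" "s' = (k', e')" by (cases s, cases s')
  have pos: "state_of (k, e) i = (if i = k then 1 else 0) + (if i = k + e then 1 else 0)" for k e i
    by (simp add: state_of_def)
  have 1: "k = k' \<or> k = k' + e'"
    using assms[of k] unfolding s pos by (simp split: if_splits)
  have 2: "k + e = k' \<or> k + e = k' + e'"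
    using assms[of "k + e"] unfolding s pos by (simp split: if_splits)
  have 3: "e' = 0" if "e = 0"
    using assms[of k] that unfolding s pos by (simp split: if_splits)
  show ?thesis
    using 1 2 3 unfolding s by (cases "e = 0") auto
qed

lemma inj_state_of: "inj state_of"
  by (rule injI, rule state_of_le_imp_eq) simp

lemma step_iff: "(\<forall>i. state_of s (Suc i) \<le> state_of s' i) \<longleftrightarrow> step s s'"
proof (cases s)
  case (Pair k e)
  obtain k' e' where s': "s' = (k', e')" by (cases s')
  show ?thesis
  proof (cases k)
    case (Suc j)
    have *: "state_of s (Suc i) = state_of (j, e) i" for i
      by (auto simp: state_of_def Pair Suc)
    show ?thesis
      unfolding * using state_of_le_imp_eq[of "(j, e)" s'] by (auto simp: Pair Suc)
  next
    case 0
    show ?thesis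
      by (cases e) (auto simp: Pair 0 state_of_def s' of_bool_def split: if_splits)
  qed
qed

lemma state_of_in_states: "state_of s \<in> multiplex_states"
proof -
  obtain k e where s: "s = (k, e)" by (cases s)
  have *: "{i. state_of s i \<noteq> 0} = {k, k + e}"
    by (auto simp: s state_of_def)
  show ?thesis
    unfolding multiplex_states_def mem_Collect_eq *
    by (cases "e = 0") (auto simp: s state_of_def of_bool_def)
qed

lemma multiplex_states_eq: "multiplex_states = range state_of"
proof
  show "range state_of \<subseteq> multiplex_states"
    using state_of_in_states by auto
  show "multiplex_states \<subseteq> range state_of"
  proof
    fix \<alpha> assume "\<alpha> \<in> multiplex_states"
    then have vals: "\<And>i. \<alpha> i \<in> {0, 1, 2}" and fin: "finite {i. \<alpha> i \<noteq> 0}"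
      and sum: "(\<Sum>i | \<alpha> i \<noteq> 0. \<alpha> i) = 2"
      unfolding multiplex_states_def by auto
    from sum obtain k where k: "\<alpha> k \<noteq> 0" by fastforce
    have sum': "\<alpha> k + sum \<alpha> ({i. \<alpha> i \<noteq> 0} - {k}) = 2"
      using sum.remove[OF fin, of k \<alpha>] k sum by simp
    have "\<exists>k e. \<alpha> = state_of (k, e)"
    proof (cases "\<alpha> k = 2")
      case True
      then have "\<alpha> i = 0" if "i \<noteq> k" for i
        using sum' fin that by auto
      then have "\<alpha> = state_of (k, 0)"
        using True by (auto simp: state_of_def fun_eq_iff)
      then show ?thesis by blast
    next
      case False
      then have k1: "\<alpha> k = 1" using vals[of k] k by auto
      then have "sum \<alpha> ({i. \<alpha> i \<noteq> 0} - {k}) = Suc 0" using sum' by simp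
      then have "\<exists>j\<in>{i. \<alpha> i \<noteq> 0} - {k}. \<alpha> j = Suc 0 \<and> (\<forall>i\<in>{i. \<alpha> i \<noteq> 0} - {k}. j \<noteq> i \<longrightarrow> \<alpha> i = 0)"
        using sum_eq_Suc0_iff[of "{i. \<alpha> i \<noteq> 0} - {k}" \<alpha>] fin by blast
      then obtain j where j: "j \<noteq> k" "\<alpha> j = Suc 0"
        and other: "\<forall>i\<in>{i. \<alpha> i \<noteq> 0} - {k}. j \<noteq> i \<longrightarrow> \<alpha> i = 0"
        by blast
      have other': "\<alpha> i = 0" if "i \<noteq> k" "i \<noteq> j" for i
        using other[rule_format, of i] that by (cases "\<alpha> i = 0") simp_all
      have "\<alpha> i = of_bool (i = k) + of_bool (i = j)" for i
        using k1 j other'[of i] by (cases "i = k"; cases "i = j") simp_all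
      then have "\<alpha> = state_of (if j < k then (j, k - j) else (k, j - k))"
        using j(1) by (simp add: state_of_def fun_eq_iff add.commute)
      then show ?thesis by metis
    qed
    then show "\<alpha> \<in> range state_of" by auto
  qed
qed

section \<open>Cycles of the state graph as cyclic lists of vertices\<close>

definition vertex_cycles :: "nat \<Rightarrow> (nat \<times> nat) list set" where
  "vertex_cycles n = {vs. vs \<noteq> [] \<and> length vs = n \<and> distinct vs \<and>
     (\<forall>(s, s') \<in> set (zip vs (rotate1 vs)). step s s')}"

definition arcs_of :: "(nat \<times> nat) list \<Rightarrow> ((nat \<Rightarrow> nat) \<times> (nat \<Rightarrow> nat)) list" where
  "arcs_of vs = map (map_prod state_of state_of) (zip vs (rotate1 vs))"

lemma cas_with_proj_iff:
  "pre_digraph.cas (with_proj G) u p v \<longleftrightarrow> map fst p @ [v] = u # map snd p"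
proof (induction p arbitrary: u)
  case Nil
  then show ?case by (auto simp: pre_digraph.cas.simps)
next
  case (Cons a p)
  then show ?case by (cases a) (auto simp: pre_digraph.cas.simps)
qed

text \<open>A list of arcs closes up exactly when its heads are its tails rotated by one place. The
  vertices that a cycle must not repeat are then, up to rotation, the tails.\<close>

lemma cycle_with_proj_iff:
  "pre_digraph.cycle (with_proj G) p \<longleftrightarrow>
     p \<noteq> [] \<and> fst (hd p) \<in> pverts G \<and> set p \<subseteq> parcs G \<and> distinct (map fst p) \<and>
     map snd p = rotate1 (map fst p)"
proof (cases p)
  case Nil
  then show ?thesis by (simp add: pre_digraph.cycle_def)
next
  case (Cons a q)
  have cas: "pre_digraph.cas (with_proj G) u p u \<longleftrightarrow> u = fst a \<and> map snd p = rotate1 (map fst p)" for u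
    unfolding cas_with_proj_iff by (auto simp: Cons)
  have verts: "tl (pre_digraph.awalk_verts (with_proj G) (fst a) p) = rotate1 (map fst p)"
    if "map snd p = rotate1 (map fst p)"
  proof -
    have "snd (last p) = fst a"
      using that Cons by (metis last_map last_snoc list.distinct(1) list.simps(9) rotate1.simps(2))
    then show ?thesis
      by (simp add: pre_digraph.awalk_verts_conv Cons)
  qed
  show ?thesis
  proof (cases "map snd p = rotate1 (map fst p)")
    case True
    then have "distinct (tl (pre_digraph.awalk_verts (with_proj G) (fst a) p)) = distinct (map fst p)"
      using verts by simp
    then show ?thesis
      unfolding pre_digraph.cycle_def pre_digraph.awalk_def cas using True Cons by auto
  next
    case False
    then show ?thesis
      unfolding pre_digraph.cycle_def pre_digraph.awalk_def cas by blast
  qed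
qed

lemma arcs_of_fst [simp]: "map fst (arcs_of vs) = map state_of vs"
  unfolding arcs_of_def by (rule nth_equalityI) auto

lemma arcs_of_snd [simp]: "map snd (arcs_of vs) = rotate1 (map state_of vs)"
  unfolding arcs_of_def rotate1_map by (rule nth_equalityI) auto

lemma length_arcs_of [simp]: "length (arcs_of vs) = length vs"
  by (simp add: arcs_of_def)

lemma inj_arcs_of: "inj arcs_of"
proof (rule injI)
  fix vs vs' assume "arcs_of vs = arcs_of vs'"
  then have "map state_of vs = map state_of vs'" by (metis arcs_of_fst)
  then show "vs = vs'" using inj_state_of by (metis inj_map_eq_map)
qed

lemma multiplex_cycles_eq: "multiplex_cycles n = arcs_of ` vertex_cycles n"
proof
  show "arcs_of ` vertex_cycles n \<subseteq> multiplex_cycles n"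
  proof
    fix p assume "p \<in> arcs_of ` vertex_cycles n"
    then obtain vs where vs: "p = arcs_of vs" "vs \<in> vertex_cycles n" by auto
    then have vs': "vs \<noteq> []" "length vs = n" "distinct vs"
      "\<And>s s'. (s, s') \<in> set (zip vs (rotate1 vs)) \<Longrightarrow> step s s'"
      by (auto simp: vertex_cycles_def)
    have "p \<noteq> []" using vs vs' by (metis length_0_conv length_arcs_of)
    moreover have "fst (hd p) \<in> multiplex_states"
      using \<open>p \<noteq> []\<close> vs arcs_of_fst[of vs] state_of_in_states vs'(1)
      by (metis hd_map)
    moreover have "set p \<subseteq> parcs multiplex_state_graph"
      using vs'(4) state_of_in_states
      by (auto simp: vs arcs_of_def multiplex_state_graph_def step_iff[rule_format])
        (metis step_iff)
    moreover have "distinct (map fst p)"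
      using vs'(3) inj_on_subset[OF inj_state_of] by (simp add: vs distinct_map)
    ultimately show "p \<in> multiplex_cycles n"
      using vs vs' rotate1_map unfolding multiplex_cycles_def cycle_with_proj_iff
      by (auto simp: multiplex_state_graph_def)
  qed
  show "multiplex_cycles n \<subseteq> arcs_of ` vertex_cycles n"
  proof
    fix p assume "p \<in> multiplex_cycles n"
    then have p: "p \<noteq> []" "set p \<subseteq> parcs multiplex_state_graph" "distinct (map fst p)"
      "map snd p = rotate1 (map fst p)" "length p = n"
      unfolding multiplex_cycles_def cycle_with_proj_iff by auto
    have "set (map fst p) \<subseteq> range state_of"
      using p(2) by (auto simp: multiplex_state_graph_def multiplex_states_eq)
    then have vs: "map fst p = map state_of (map (inv state_of) (map fst p))"
      unfolding map_map by (intro map_cong) (auto simp: f_inv_into_f subset_iff)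
    define vs where "vs = map (inv state_of) (map fst p)"
    note vs = vs[folded vs_def]
    have pv: "p = arcs_of vs"
      using p(4) vs by (metis arcs_of_fst arcs_of_snd zip_map_fst_snd)
    have len: "length vs = n" using p(5) pv by simp
    have "distinct vs" using p(3) vs by (simp add: distinct_map)
    moreover have "step s s'" if "(s, s') \<in> set (zip vs (rotate1 vs))" for s s'
    proof -
      have "(state_of s, state_of s') \<in> set p"
        using that by (force simp: pv arcs_of_def)
      then have "\<forall>i. state_of s (Suc i) \<le> state_of s' i"
        using p(2) by (auto simp: multiplex_state_graph_def)
      then show ?thesis by (rule step_iff[THEN iffD1])
    qed
    moreover have "vs \<noteq> []" using p(1) len p(5) by auto
    ultimately show "p \<in> arcs_of ` vertex_cycles n"
      using pv len by (auto simp: vertex_cycles_def)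
  qed
qed

section \<open>Rotation classes and their representatives\<close>

lemma zip_rotate1: "length xs = length ys \<Longrightarrow> zip (rotate1 xs) (rotate1 ys) = rotate1 (zip xs ys)"
  by (cases xs; cases ys) auto

lemma arcs_of_rotate: "arcs_of (rotate k vs) = rotate k (arcs_of vs)"
proof (induction k)
  case (Suc k)
  have "arcs_of (rotate1 us) = rotate1 (arcs_of us)" for us
    by (simp add: arcs_of_def zip_rotate1 rotate1_map)
  then show ?case using Suc by simp
qed simp

lemma rotate_in_vertex_cycles:
  assumes "vs \<in> vertex_cycles n"
  shows "rotate k vs \<in> vertex_cycles n"
proof -
  have "zip (rotate k us) (rotate1 (rotate k us)) = rotate k (zip us (rotate1 us))" for us :: "(nat \<times> nat) list"
  proof (induction k)
    case (Suc k)
    then show ?case by (simp add: zip_rotate1)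
  qed simp
  then show ?thesis using assms by (auto simp: vertex_cycles_def)
qed

lemma equiv_rotation_rel: "equiv A (rotation_rel A)"
proof (rule equivI)
  show "refl_on A (rotation_rel A)"
  proof (rule refl_onI)
    fix p assume "p \<in> A"
    moreover have "p = rotate 0 p" by simp
    ultimately show "(p, p) \<in> rotation_rel A" unfolding rotation_rel_def by blast
  qed
  show "rotation_rel A \<subseteq> A \<times> A" by (auto simp: rotation_rel_def)
  show "sym (rotation_rel A)"
  proof (rule symI)
    fix p q assume "(p, q) \<in> rotation_rel A"
    then obtain k where k: "p \<in> A" "q \<in> A" "q = rotate k p" by (auto simp: rotation_rel_def)
    have "p = rotate (length p - k mod length p) q"
    proof (cases "p = []")
      case False
      have "rotate (length p - k mod length p) (rotate (k mod length p) p) = p"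
        using False by (simp add: rotate_rotate mod_less_divisor less_imp_le)
      then show ?thesis using k(3) rotate_conv_mod by metis
    qed (simp add: k)
    then show "(q, p) \<in> rotation_rel A" using k unfolding rotation_rel_def by blast
  qed
  show "trans (rotation_rel A)"
    by (rule transI) (auto simp: rotation_rel_def rotate_rotate)
qed

text \<open>Each rotation class is represented by its member that ends in the key 0 or, if the cycle
  avoids that key, in the largest key.\<close>

definition canonical_cycles :: "nat \<Rightarrow> (nat \<times> nat) list set" where
  "canonical_cycles n = {vs \<in> vertex_cycles n. fst (last vs) = 0 \<and>
     (\<forall>e. (0, e) \<in> set vs \<longrightarrow> snd (last vs) = 0 \<or> 0 < e \<and> e \<le> snd (last vs))}"

text \<open>A vertex with the smallest lower index \<open>K\<close> is a key: for positive
  \<open>K\<close> its successor on the cycle would have the lower index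
  \<open>K - 1\<close>.\<close>

lemma vertex_cycle_has_key:
  assumes "vs \<in> vertex_cycles n"
  shows "\<exists>e. (0, e) \<in> set vs"
proof -
  have ne: "vs \<noteq> []" and st: "\<forall>(s, s') \<in> set (zip vs (rotate1 vs)). step s s'"
    using assms by (auto simp: vertex_cycles_def)
  define K where "K = Min (fst ` set vs)"
  have "K \<in> fst ` set vs" unfolding K_def using ne by (intro Min_in) auto
  then obtain e where e: "(K, e) \<in> set vs" by auto
  show ?thesis
  proof (cases K)
    case (Suc j)
    obtain i where i: "i < length vs" "vs ! i = (K, e)" using e by (auto simp: in_set_conv_nth)
    have "(vs ! i, rotate1 vs ! i) \<in> set (zip vs (rotate1 vs))"
      using i by (auto simp: set_zip intro!: exI[of _ i])
    then have "rotate1 vs ! i = (j, e)" using st i Suc by auto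
    then have "(j, e) \<in> set vs" using i by (metis length_rotate1 nth_mem set_rotate1)
    then have "K \<le> j" unfolding K_def by (intro Min_le) force+
    then show ?thesis using Suc by simp
  qed (use e in auto)
qed

lemma ex_rotate_last:
  assumes "x \<in> set xs"
  shows "\<exists>k. last (rotate k xs) = x"
proof -
  obtain ys zs where xs: "xs = ys @ x # zs" using assms by (meson split_list)
  have "rotate (length (ys @ [x])) ((ys @ [x]) @ zs) = zs @ (ys @ [x])"
    by (rule rotate_append)
  then show ?thesis using xs by (intro exI[of _ "length (ys @ [x])"]) simp
qed

lemma ex_canonical_rotation:
  assumes "vs \<in> vertex_cycles n"
  shows "\<exists>k. rotate k vs \<in> canonical_cycles n"
proof -
  define E where "E = {e. (0, e) \<in> set vs}"
  have "E = snd ` ({s \<in> set vs. fst s = 0})" by (force simp: E_def)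
  then have fin: "finite E" by simp
  have ne: "E \<noteq> {}" using vertex_cycle_has_key[OF assms] by (auto simp: E_def)
  define z where "z = (if 0 \<in> E then 0 else Max E)"
  have "z \<in> E" using fin ne by (auto simp: z_def)
  then obtain k where k: "last (rotate k vs) = (0, z)"
    using ex_rotate_last by (metis E_def mem_Collect_eq)
  have "z = 0 \<or> 0 < e \<and> e \<le> z" if "(0, e) \<in> set vs" for e
    using that fin unfolding z_def by (auto simp: E_def intro!: gr0I)
  then have "rotate k vs \<in> canonical_cycles n"
    using rotate_in_vertex_cycles[OF assms, of k] k by (auto simp: canonical_cycles_def)
  then show ?thesis by blast
qed

text \<open>Without repetitions the last entry fixes the rotation, so a rotation class has only one
  member with a prescribed last vertex.\<close>

lemma rotate_last_unique:
  assumes "distinct xs" "last (rotate k xs) = last xs"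
  shows "rotate k xs = xs"
proof (cases "xs = []")
  case False
  define j where "j = k mod length xs"
  have j: "j < length xs" using False by (simp add: j_def)
  have r: "rotate k xs = drop j xs @ take j xs"
    by (simp add: rotate_drop_take j_def)
  show ?thesis
  proof (cases "j = 0")
    case False
    then have "last (rotate k xs) = xs ! (j - 1)"
      unfolding r using j \<open>xs \<noteq> []\<close> by (simp add: last_append last_conv_nth)
    then have "xs ! (j - 1) = xs ! (length xs - 1)"
      using assms(2) \<open>xs \<noteq> []\<close> by (simp add: last_conv_nth)
    then have "j - 1 = length xs - 1"
      using assms(1) j by (subst (asm) nth_eq_iff_index_eq) auto
    then show ?thesis using j False by linarith
  qed (simp add: r)
qed simp

lemma num_multiplex_primes_eq: "num_multiplex_primes n = card (canonical_cycles n)"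
proof -
  let ?A = "multiplex_cycles n"
  let ?R = "rotation_rel ?A"
  have cyc: "arcs_of vs \<in> ?A" if "vs \<in> vertex_cycles n" for vs
    using that by (auto simp: multiplex_cycles_eq)
  have "bij_betw (\<lambda>vs. ?R `` {arcs_of vs}) (canonical_cycles n) (?A // ?R)"
  proof (rule bij_betwI')
    fix vs vs' assume v: "vs \<in> canonical_cycles n" "vs' \<in> canonical_cycles n"
    show "(?R `` {arcs_of vs} = ?R `` {arcs_of vs'}) = (vs = vs')"
    proof
      assume eq: "?R `` {arcs_of vs} = ?R `` {arcs_of vs'}"
      have mem: "arcs_of vs \<in> ?A" "arcs_of vs' \<in> ?A"
        using v cyc by (auto simp: canonical_cycles_def)
      have "(arcs_of vs, arcs_of vs') \<in> ?R"
        using eq_equiv_class[OF eq equiv_rotation_rel] mem by blast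
      then obtain k where "arcs_of vs' = rotate k (arcs_of vs)"
        by (auto simp: rotation_rel_def)
      then have vs': "vs' = rotate k vs"
        by (metis arcs_of_rotate inj_arcs_of injD)
      have "vs \<noteq> []" "vs' \<noteq> []" and d: "distinct vs"
        using v by (auto simp: canonical_cycles_def vertex_cycles_def)
      then have l: "last vs \<in> set vs" "last vs' \<in> set vs'" "set vs' = set vs"
        using vs' by (metis last_in_set, metis last_in_set, simp)
      have canon: "fst (last us) = 0"
        "(0, e) \<in> set us \<Longrightarrow> snd (last us) = 0 \<or> 0 < e \<and> e \<le> snd (last us)"
        if "us \<in> canonical_cycles n" for us e
        using that by (auto simp: canonical_cycles_def)
      have *: "last vs = (0, snd (last vs))" "last vs' = (0, snd (last vs'))"
        using canon(1) v by (simp_all add: prod_eq_iff)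
      \<comment> \<open>The last key of each representative also occurs in the other one. Hence both
        are 0, or both are the same largest key.\<close>
      have "snd (last vs) = 0 \<or> 0 < snd (last vs') \<and> snd (last vs') \<le> snd (last vs)"
        using canon(2)[OF v(1)] l * by metis
      moreover have "snd (last vs') = 0 \<or> 0 < snd (last vs) \<and> snd (last vs) \<le> snd (last vs')"
        using canon(2)[OF v(2)] l * by metis
      ultimately have "last vs = last vs'"
        using * by (metis le_antisym less_irrefl)
      then show "vs = vs'"
        using rotate_last_unique[of vs k] d vs' by simp
    qed simp
  next
    fix vs assume "vs \<in> canonical_cycles n"
    then show "?R `` {arcs_of vs} \<in> ?A // ?R"
      using cyc by (auto simp: canonical_cycles_def intro: quotientI)
  next
    fix X assume "X \<in> ?A // ?R"
    then obtain vs where vs: "vs \<in> vertex_cycles n" "X = ?R `` {arcs_of vs}"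
      by (auto simp: multiplex_cycles_eq elim!: quotientE)
    obtain k where k: "rotate k vs \<in> canonical_cycles n"
      using ex_canonical_rotation[OF vs(1)] by blast
    have "(arcs_of vs, arcs_of (rotate k vs)) \<in> ?R"
      using cyc[OF vs(1)] cyc[OF rotate_in_vertex_cycles[OF vs(1)], of k]
      by (auto simp: rotation_rel_def arcs_of_rotate)
    then have "X = ?R `` {arcs_of (rotate k vs)}"
      unfolding vs(2) by (rule equiv_class_eq[OF equiv_rotation_rel])
    then show "\<exists>vs\<in>canonical_cycles n. X = ?R `` {arcs_of vs}" using k by blast
  qed
  then show ?thesis
    unfolding num_multiplex_primes_def multiplex_prime_patterns_def
    by (metis bij_betw_same_card)
qed

section \<open>Walks between keys as lists of blocks\<close>

lemma zip_rotate1_successively: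
  assumes "xs \<noteq> []"
  shows "(\<forall>(x, y) \<in> set (zip xs (rotate1 xs)). P x y) \<longleftrightarrow> successively P xs \<and> P (last xs) (hd xs)"
proof -
  have "(\<forall>(x, y) \<in> set (zip (z # zs) (zs @ [w])). P x y) \<longleftrightarrow>
      successively P (z # zs) \<and> P (last (z # zs)) w" for z zs w
    by (induction zs arbitrary: z) auto
  then show ?thesis using assms by (cases xs) auto
qed

section \<open>Descents between throws\<close>

fun descent :: "nat \<Rightarrow> nat \<Rightarrow> (nat \<times> nat) list" where
  "descent 0 e = [(0, e)]"
| "descent (Suc k) e = (Suc k, e) # descent k e"

lemma descent_not_Nil [simp]: "descent k e \<noteq> []"
  by (cases k) auto

lemma hd_descent [simp]: "hd (descent k e) = (k, e)"
  by (cases k) auto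

lemma last_descent [simp]: "last (descent k e) = (0, e)"
  by (induction k) auto

lemma length_descent [simp]: "length (descent k e) = Suc k"
  by (induction k) auto

lemma set_descent [simp]: "set (descent k e) = {..k} \<times> {e}"
  by (induction k) (auto simp: le_Suc_eq)

lemma distinct_descent [simp]: "distinct (descent k e)"
  by (induction k) auto

lemma successively_descent [simp]: "successively step (descent k e)"
  by (induction k) (auto simp: successively_Cons)

lemma descent_append_eq_iff [simp]:
  "descent k e @ vs = descent k' e' @ vs' \<longleftrightarrow> k = k' \<and> e = e' \<and> vs = vs'"
proof
  assume eq: "descent k e @ vs = descent k' e' @ vs'"
  then have "hd (descent k e @ vs) = hd (descent k' e' @ vs')" by simp
  then have "(k, e) = (k', e')" by (simp add: hd_append)
  then show "k = k' \<and> e = e' \<and> vs = vs'" using eq by simp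
qed simp

lemma descent_append_eq_descent_iff [simp]:
  "descent k e @ vs = descent k' e' \<longleftrightarrow> k = k' \<and> e = e' \<and> vs = []"
  "descent k' e' = descent k e @ vs \<longleftrightarrow> k = k' \<and> e = e' \<and> vs = []"
  "descent k e = descent k' e' \<longleftrightarrow> k = k' \<and> e = e'"
  using descent_append_eq_iff[of k e vs k' e' "[]"] descent_append_eq_iff[of k e "[]" k' e' "[]"]
  by auto

text \<open>While the lower index is positive the next state is forced, and the walk cannot stop
  before that index reaches 0.\<close>

lemma ex_descent_prefix:
  assumes "successively step ((k, e) # vs)" "fst (last ((k, e) # vs)) = 0"
  shows "\<exists>vs'. (k, e) # vs = descent k e @ vs'"
  using assms
proof (induction k arbitrary: vs)
  case (Suc k)
  then obtain vs1 where "vs = (k, e) # vs1"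
    by (cases vs) auto
  then show ?case using Suc by auto
qed simp

lemma key_in_set:
  assumes "successively step vs" "fst (last vs) = 0" "(k, e) \<in> set vs"
  shows "(0, e) \<in> set vs"
proof -
  obtain ys zs where vs: "vs = ys @ (k, e) # zs" using assms(3) by (meson split_list)
  obtain vs' where "(k, e) # zs = descent k e @ vs'"
    using ex_descent_prefix[of k e zs] assms(1,2) vs by (auto simp: successively_append_iff)
  then show ?thesis by (auto simp: vs)
qed

text \<open>In case \<open>inner\<close> the value \<open>e\<close> cannot recur: by
  \<open>key_in_set\<close>, a later state \<open>(k, e)\<close> would force a second visit to the
  key \<open>(0, e)\<close>, against distinctness.\<close>

lemma split_descent:
  assumes "successively step vs" "vs \<noteq> []" "last vs = (0, z)" "distinct vs"
  obtains (final) k where "vs = descent k z"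
  | (inner) k e vs' where "vs = descent k e @ vs'" "vs' \<noteq> []" "e \<noteq> z" "last vs' = (0, z)"
      "e \<notin> snd ` set vs'" "successively step ((0, e) # vs')" "distinct vs'"
proof -
  obtain k e vs0 where vs0: "vs = (k, e) # vs0" using assms(2) by (cases vs) auto
  obtain vs' where vs: "vs = descent k e @ vs'"
    using ex_descent_prefix[of k e vs0] assms vs0 by auto
  show thesis
  proof (cases "vs' = []")
    case True
    then show ?thesis using final[of k] assms(3) vs by simp
  next
    case False
    have l: "last vs' = (0, z)" using assms(3) vs False by simp
    have dis: "distinct vs'" "(0, e) \<notin> set vs'" using assms(4) by (auto simp: vs)
    have suc: "successively step ((0, e) # vs')"
      using assms(1) False by (simp add: vs successively_append_iff successively_Cons)
    have "e \<noteq> z" using dis l False by (metis last_in_set)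
    moreover have "e \<notin> snd ` set vs'"
      using key_in_set[of vs' _ e] suc l dis(2) by (auto simp: successively_Cons)
    ultimately show ?thesis using inner vs False l dis(1) suc by blast
  qed
qed

section \<open>Block lists and the walks that they encode\<close>

definition block_lists :: "nat set list set" where
  "block_lists = {bs. distinct bs \<and> disjoint (set bs) \<and> (\<forall>B\<in>set bs. finite B \<and> B \<noteq> {} \<and> 0 \<notin> B)}"

lemma Nil_block_lists [simp]: "[] \<in> block_lists"
  by (simp add: block_lists_def)

lemma Cons_block_lists [simp]:
  "B # bs \<in> block_lists \<longleftrightarrow>
     bs \<in> block_lists \<and> finite B \<and> B \<noteq> {} \<and> 0 \<notin> B \<and> B \<inter> \<Union>(set bs) = {}"
proof
  assume *: "B # bs \<in> block_lists"
  have "B \<inter> C = {}" if "C \<in> set bs" for C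
    using * that unfolding block_lists_def disjoint_def by fastforce
  then show "bs \<in> block_lists \<and> finite B \<and> B \<noteq> {} \<and> 0 \<notin> B \<and> B \<inter> \<Union>(set bs) = {}"
    using * by (auto simp: block_lists_def disjoint_def)
next
  assume *: "bs \<in> block_lists \<and> finite B \<and> B \<noteq> {} \<and> 0 \<notin> B \<and> B \<inter> \<Union>(set bs) = {}"
  then have "B \<notin> set bs" by blast
  moreover have "disjoint (insert B (set bs))"
    unfolding disjoint_def
  proof (intro ballI impI)
    fix C D assume "C \<in> insert B (set bs)" "D \<in> insert B (set bs)" "C \<noteq> D"
    then consider "C \<in> set bs" "D \<in> set bs" | "C = B" "D \<in> set bs" | "D = B" "C \<in> set bs"
      by blast
    then show "C \<inter> D = {}"
      using * \<open>C \<noteq> D\<close> by cases (simp_all add: block_lists_def disjoint_def, blast+)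
  qed
  ultimately show "B # bs \<in> block_lists"
    using * by (simp add: block_lists_def)
qed

text \<open>\<open>block_path z d vs bs\<close>: the walk \<open>vs\<close> leads from the key \<open>d\<close> to the key \<open>z\<close>, and \<open>bs\<close> lists its
  decreasing runs of keys, starting with \<open>d\<close> and leaving out the final \<open>z\<close>. The rules \<open>over\<close> and
  \<open>under\<close> are the two kinds of throw from \<open>d\<close>.\<close>

inductive block_path :: "nat \<Rightarrow> nat \<Rightarrow> (nat \<times> nat) list \<Rightarrow> nat set list \<Rightarrow> bool" for z where
  final: "0 < d \<Longrightarrow> block_path z d (descent (d - 1) z) [{d}]"
| over: "block_path z e vs bs \<Longrightarrow> 0 < d \<Longrightarrow> d \<notin> \<Union>(set bs) \<Longrightarrow> e \<noteq> z \<Longrightarrow>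
    block_path z d (descent (d - 1) e @ vs) ({d} # bs)"
| under: "block_path z e vs (B # bs) \<Longrightarrow> e < d \<Longrightarrow> d \<notin> \<Union>(set (B # bs)) \<Longrightarrow> e \<noteq> z \<Longrightarrow>
    block_path z d (descent (d - e - 1) e @ vs) (insert d B # bs)"

lemma block_path_blocks:
  assumes "block_path z d vs bs"
  shows "0 < d" "bs \<noteq> []" "bs \<in> block_lists" "Max (hd bs) = d" "d \<in> hd bs"
proof -
  have "0 < d \<and> bs \<noteq> [] \<and> bs \<in> block_lists \<and> Max (hd bs) = d \<and> d \<in> hd bs"
    using assms by induction auto
  then show "0 < d" "bs \<noteq> []" "bs \<in> block_lists" "Max (hd bs) = d" "d \<in> hd bs" by blast+
qed

text \<open>The walk \<open>vs\<close> begins after the key \<open>d\<close>, so \<open>d\<close> is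
  among its keys only if it is also the target. Allowing \<open>d = z\<close> lets one relation
  cover both the walks that end in the key 0 and the closed walks at a largest key.\<close>

lemma block_path_keys:
  assumes "block_path z d vs bs"
  shows "z \<notin> \<Union>(set bs) - {d}" "snd ` set vs = insert z (\<Union>(set bs) - {d})"
proof -
  have "z \<notin> \<Union>(set bs) - {d} \<and> snd ` set vs = insert z (\<Union>(set bs) - {d})"
    using assms
  proof induction
    case (final d)
    then show ?case by auto
  next
    case (over e vs bs d)
    then have "e \<in> \<Union>(set bs)" using block_path_blocks[OF over.hyps(1)] by (cases bs) auto
    then show ?case using over by (auto simp: image_Un)
  next
    case (under e vs B bs d)
    then have "e \<in> B" using block_path_blocks[OF under.hyps(1)] by auto
    then show ?case using under by (auto simp: image_Un)
  qed
  then show "z \<notin> \<Union>(set bs) - {d}" "snd ` set vs = insert z (\<Union>(set bs) - {d})" by blast+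
qed

text \<open>The length telescopes: a throw above adds \<open>d\<close> states, the maximum of the
  new block \<open>{d}\<close>; a throw below adds \<open>d - e\<close> states and raises the
  maximum of the first block from \<open>e\<close> to \<open>d\<close>. No state repeats, because by
  \<open>block_path_keys\<close> the key \<open>e\<close> of a new descent is absent from the rest
  of the walk.\<close>

lemma block_path_walk:
  assumes "block_path z d vs bs"
  shows "vs \<noteq> []" "last vs = (0, z)" "successively step ((0, d) # vs)" "distinct vs"
    "length vs = sum_list (map Max bs)"
proof -
  have "vs \<noteq> [] \<and> last vs = (0, z) \<and> successively step ((0, d) # vs) \<and> distinct vs \<and>
    length vs = sum_list (map Max bs)"
    using assms
  proof induction
    case (final d)
    then show ?case by (cases d) (auto simp: successively_Cons)
  next
    case (over e vs bs d)
    have "e \<notin> snd ` set vs"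
      using block_path_keys[OF over.hyps(1)] over.hyps by auto
    then have "set (descent k e) \<inter> set vs = {}" for k by force
    then have dis: "distinct (descent (d - 1) e @ vs)" using over.IH by simp
    have "step (0, d) (d - 1, e)" using over.hyps(2) by (cases d) auto
    moreover have "length (descent (d - 1) e @ vs) = sum_list (map Max ({d} # bs))"
      using over.IH over.hyps(2) by simp
    ultimately show ?case using over.IH dis
      by (auto simp: successively_Cons successively_append_iff)
  next
    case (under e vs B bs d)
    have "e \<notin> snd ` set vs"
      using block_path_keys[OF under.hyps(1)] under.hyps by auto
    then have "set (descent k e) \<inter> set vs = {}" for k by force
    then have dis: "distinct (descent (d - e - 1) e @ vs)" using under.IH by simp
    have B: "finite B" "B \<noteq> {}" "Max B = e" using block_path_blocks[OF under.hyps(1)] by auto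
    have "Max (insert d B) = d" using B under.hyps(2) by (auto intro: max_absorb1)
    moreover have "length vs = e + sum_list (map Max bs)" using under.IH B by simp
    ultimately have "length (descent (d - e - 1) e @ vs) = sum_list (map Max (insert d B # bs))"
      using under.hyps(2) by (simp del: Max_insert)
    moreover have "step (0, d) (d - e - 1, e)" using under.hyps(2) by (cases d) auto
    ultimately show ?case using under.IH dis
      by (auto simp: successively_Cons successively_append_iff)
  qed
  then show "vs \<noteq> []" "last vs = (0, z)" "successively step ((0, d) # vs)" "distinct vs"
    "length vs = sum_list (map Max bs)" by blast+
qed

text \<open>The walk is rebuilt by deleting the largest element of the first block. The next key is
  the largest element of what is left of that block (a throw below), else of the following block (a
  throw above), and \<open>z\<close> once everything is used up.\<close>

lemma block_path_of_blocks:
  assumes "bs \<in> block_lists" "bs \<noteq> []" "z \<notin> \<Union>(set bs) - {Max (hd bs)}"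
  shows "\<exists>vs. block_path z (Max (hd bs)) vs bs"
  using assms
proof (induction "sum_list (map card bs)" arbitrary: bs rule: less_induct)
  case less
  obtain B bs' where bs: "bs = B # bs'" using less.prems(2) by (cases bs) auto
  define d where "d = Max B"
  have B: "finite B" "B \<noteq> {}" "0 \<notin> B" "B \<inter> \<Union>(set bs') = {}" "bs' \<in> block_lists"
    using less.prems(1) by (auto simp: bs)
  have d: "d \<in> B" using B by (simp add: d_def)
  then have d0: "0 < d" using B(3) by (cases d) auto
  have z: "x \<noteq> z" if "x \<in> B \<or> (\<exists>C\<in>set bs'. x \<in> C)" "x \<noteq> d" for x
    using less.prems(3) that by (auto simp: bs d_def)
  show ?case
  proof (cases "B = {d}")
    case True
    show ?thesis
    proof (cases "bs' = []")
      case True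
      then show ?thesis using \<open>B = {d}\<close> d0 final[of d z] by (auto simp: bs)
    next
      case False
      then obtain B1 bs1 where bs': "bs' = B1 # bs1" by (cases bs') auto
      have e: "Max B1 \<in> B1" using B(5) by (auto simp: bs')
      then have "Max B1 \<noteq> d" using B(4) d by (auto simp: bs')
      then have ne: "Max B1 \<noteq> z" using z[of "Max B1"] e by (auto simp: bs')
      have "\<exists>vs. block_path z (Max (hd bs')) vs bs'"
      proof (rule less.hyps)
        show "sum_list (map card bs') < sum_list (map card bs)" using True by (simp add: bs)
        show "z \<notin> \<Union>(set bs') - {Max (hd bs')}"
          using z B(4) d by blast
      qed (use B False in auto)
      then obtain vs where "block_path z (Max B1) vs bs'" by (auto simp: bs')
      then have "block_path z d (descent (d - 1) (Max B1) @ vs) ({d} # bs')"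
        using ne B(4) d d0 by (intro over) auto
      then show ?thesis using True by (auto simp: bs)
    qed
  next
    case False
    define B' where "B' = B - {d}"
    have B': "finite B'" "B' \<noteq> {}" "B = insert d B'" "d \<notin> B'"
      using B d False by (auto simp: B'_def)
    have e: "Max B' \<in> B'" using B' by auto
    then have in_B: "Max B' \<in> B" "Max B' \<noteq> d" by (auto simp: B'_def)
    then have ne: "Max B' \<noteq> z" using z by blast
    have lt: "Max B' < d"
      using in_B Max_ge[OF B(1) in_B(1)] unfolding d_def by linarith
    have "\<exists>vs. block_path z (Max (hd (B' # bs'))) vs (B' # bs')"
    proof (rule less.hyps)
      show "sum_list (map card (B' # bs')) < sum_list (map card bs)"
        using card_Diff1_less[OF B(1) d] by (simp add: bs B'_def)
      show "B' # bs' \<in> block_lists"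
        using B B'(1,2) by (auto simp: B'_def)
      show "z \<notin> \<Union>(set (B' # bs')) - {Max (hd (B' # bs'))}"
        using z B(4) d by (auto simp: B'_def)
    qed simp
    then obtain vs where "block_path z (Max B') vs (B' # bs')" by auto
    then have "block_path z d (descent (d - Max B' - 1) (Max B') @ vs) (insert d B' # bs')"
      using lt ne B(4) d B'(4) by (intro under) auto
    then show ?thesis using B'(3) by (metis bs d_def list.sel(1))
  qed
qed

text \<open>The last hypothesis excludes a final throw strictly below the other ball, which would
  need \<open>0 < z\<close> and \<open>z < d\<close>. It also keeps all keys before the target
  positive.\<close>

lemma block_path_of_walk:
  assumes "successively step ((0, d) # vs)" "0 < d" "vs \<noteq> []" "last vs = (0, z)" "distinct vs"
    "d = z \<or> d \<notin> snd ` set vs"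
    "z = 0 \<or> d \<le> z \<and> (\<forall>e \<in> snd ` set vs. 0 < e \<and> e \<le> z)"
  shows "\<exists>bs. block_path z d vs bs"
  using assms
proof (induction "length vs" arbitrary: d vs rule: less_induct)
  case less
  have suc: "successively step vs" "step (0, d) (hd vs)"
    using less.prems(1,3) by (auto simp: successively_Cons)
  obtain d' where d': "d = Suc d'" using less.prems(2) by (cases d) auto
  from suc(1) less.prems(3,4,5) show ?case
  proof (cases rule: split_descent)
    case (final k)
    then have "k = d - 1" using suc(2) less.prems(7) by (auto simp: d')
    then show ?thesis using final block_path.final[OF less.prems(2), of z] by auto
  next
    case (inner k e vs')
    have e: "z = 0 \<or> 0 < e \<and> e \<le> z" using less.prems(7) inner(1) by (auto simp: image_Un)
    then have "0 < e" using inner(3) by auto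
    have "\<exists>bs. block_path z e vs' bs"
      by (rule less.hyps) (use inner \<open>0 < e\<close> e less.prems(7) in auto)
    then obtain bs where bs: "block_path z e vs' bs" by blast
    have "d \<notin> \<Union>(set bs)"
      using less.prems(6) block_path_keys[OF bs] inner by (auto simp: image_Un)
    moreover have "k = d - 1 \<or> e < d \<and> k = d - e - 1"
      using suc(2) \<open>0 < e\<close> inner(1) by (auto simp: d' hd_append)
    moreover obtain B bs' where "bs = B # bs'"
      using block_path_blocks(2)[OF bs] by (cases bs) auto
    ultimately show ?thesis
      using over[OF bs less.prems(2)] under[of z e vs' B bs' d] bs inner by blast
  qed
qed

text \<open>The height of the first descent tells the two throws apart, \<open>d - 1\<close> against
  \<open>d - e - 1\<close>, because \<open>e\<close> is positive.\<close>

lemma block_path_functional: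
  assumes "block_path z d vs bs" "block_path z d vs bs'"
  shows "bs = bs'"
  using assms
proof (induction arbitrary: bs')
  case (final d)
  from final.prems show ?case
    by cases (simp_all add: block_path_walk(1))
next
  case (over e vs bs d)
  note e = block_path_blocks(1)[OF over.hyps(1)]
  from over.prems show ?case
  proof cases
    case final
    then show ?thesis using over.hyps(4) by simp
  next
    case (over e1 vs1 bs1)
    then show ?thesis using over.IH by simp
  next
    case (under e1 vs1 B1 bs1)
    have "d - 1 = d - e1 - 1" using under(1) by (metis descent_append_eq_iff)
    then show ?thesis using block_path_blocks(1)[OF under(3)] under(4) by linarith
  qed
next
  case (under e vs B bs d)
  note e = block_path_blocks(1)[OF under.hyps(1)]
  from under.prems show ?case
  proof cases
    case final
    then show ?thesis using under.hyps(4) by simp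
  next
    case (over e1 vs1 bs1)
    have "d - e - 1 = d - 1" using over(1) by (metis descent_append_eq_iff)
    then show ?thesis using e under.hyps(2) by linarith
  next
    case (under e1 vs1 B1 bs1)
    then have "B # bs = B1 # bs1" using under.IH by simp
    then show ?thesis using under by simp
  qed
qed

text \<open>The block list fixes the starting key as \<open>Max (hd bs)\<close>, and the rule
  applied is seen from whether the first block is a singleton and whether another block
  follows.\<close>

lemma block_path_injective:
  assumes "block_path z d vs bs" "block_path z d' vs' bs"
  shows "vs = vs'"
  using assms
proof (induction arbitrary: d' vs')
  case (final d)
  from final.prems show ?case
  proof cases
    case (over e1 vs1)
    then show ?thesis using block_path_blocks(2) by blast
  next
    case (under e1 vs1 B1)
    then show ?thesis using block_path_blocks(5)[OF under(3)] by auto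
  qed simp
next
  case (over e vs bs d)
  from over.prems show ?case
  proof cases
    case final
    then show ?thesis using block_path_blocks(2)[OF over.hyps(1)] by simp
  next
    case (over e1 vs1)
    then show ?thesis
      using over.IH block_path_blocks(4)[OF over.hyps(1)] block_path_blocks(4)[of z e1 vs1 bs] by auto
  next
    case (under e1 vs1 B1)
    then show ?thesis using block_path_blocks(5)[OF under(3)] by auto
  qed
next
  case (under e vs B bs d)
  have B: "e \<in> B" "Max B = e" using block_path_blocks[OF under.hyps(1)] by auto
  have d': "d' = d"
    using block_path_blocks(4)[OF under.prems]
      block_path_blocks(4)[OF block_path.under[OF under.hyps]] by simp
  from under.prems show ?case
  proof cases
    case final
    then show ?thesis using B under.hyps(3) d' by auto
  next
    case (over e1 vs1)
    then show ?thesis using B under.hyps(3) d' by auto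
  next
    case (under e1 vs1 B1)
    then have "B1 = B" using under.hyps(3) d' by auto
    then show ?thesis
      using under B block_path_blocks(4)[OF under(3)] under.IH d' by auto
  qed
qed

section \<open>The two bijections between cycles and block lists\<close>

lemma ex_bij_betw_of_relation:
  assumes "\<And>a. a \<in> A \<Longrightarrow> \<exists>b\<in>B. R a b" "\<And>b. b \<in> B \<Longrightarrow> \<exists>a\<in>A. R a b"
    and "\<And>a b b'. R a b \<Longrightarrow> R a b' \<Longrightarrow> b = b'" "\<And>a a' b. R a b \<Longrightarrow> R a' b \<Longrightarrow> a = a'"
  shows "\<exists>f. bij_betw f A B"
proof -
  obtain f where f: "\<And>a. a \<in> A \<Longrightarrow> f a \<in> B \<and> R a (f a)"
    using assms(1) by metis
  have "bij_betw f A B"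
    unfolding bij_betw_def
  proof
    show "inj_on f A" using f assms(4) by (metis inj_onI)
    have "b \<in> f ` A" if "b \<in> B" for b
      using assms(2)[OF that] f assms(3) by (metis image_eqI)
    then show "f ` A = B" using f by auto
  qed
  then show ?thesis by blast
qed

definition max_sum :: "nat set list \<Rightarrow> nat" where
  "max_sum bs = sum_list (map Max bs)"

lemma canonical_cycles_iff:
  "vs \<in> canonical_cycles n \<longleftrightarrow>
     vs \<noteq> [] \<and> length vs = n \<and> distinct vs \<and> successively step vs \<and> step (last vs) (hd vs) \<and>
     fst (last vs) = 0 \<and>
     (\<forall>e. (0, e) \<in> set vs \<longrightarrow> snd (last vs) = 0 \<or> 0 < e \<and> e \<le> snd (last vs))"
  unfolding canonical_cycles_def vertex_cycles_def mem_Collect_eq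
  using zip_rotate1_successively[of vs step] by blast

text \<open>After the key 0 the next state \<open>(a, d)\<close> is arbitrary. Its descent takes
  \<open>a + 1\<close> states, which leaves \<open>n - 1 - a\<close> for the walk from the key
  \<open>d\<close> back to 0. The empty block list stands for \<open>d = 0\<close>, where the first
  descent already closes the cycle.\<close>

lemma ex_bij_cycles_through_zero:
  "\<exists>f. bij_betw f {vs \<in> canonical_cycles n. last vs = (0, 0)}
     (SIGMA a:{..<n}. {bs \<in> block_lists. max_sum bs = n - 1 - a})"
proof (rule ex_bij_betw_of_relation)
  define R where "R = (\<lambda>vs (a, bs).
    bs = [] \<and> vs = descent a 0 \<or>
    (\<exists>d vs'. block_path 0 d vs' bs \<and> vs = descent a d @ vs'))"
  let ?A = "{vs \<in> canonical_cycles n. last vs = (0, 0)}"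
  let ?B = "SIGMA a:{..<n}. {bs \<in> block_lists. max_sum bs = n - 1 - a}"
  show "\<exists>abs\<in>?B. R vs abs" if "vs \<in> ?A" for vs
  proof -
    have vs: "vs \<noteq> []" "length vs = n" "distinct vs" "successively step vs" "last vs = (0, 0)"
      using that by (auto simp: canonical_cycles_iff)
    from vs(4,1,5,3) show ?thesis
    proof (cases rule: split_descent)
      case (final k)
      then have "(k, []) \<in> ?B" "R vs (k, [])"
        using vs(2) by (auto simp: R_def max_sum_def)
      then show ?thesis by blast
    next
      case (inner k e vs')
      then obtain bs where bs: "block_path 0 e vs' bs"
        using block_path_of_walk[of e vs' 0] by auto
      then have "(k, bs) \<in> ?B" "R vs (k, bs)"
        using vs(2) inner(1) block_path_walk(5)[OF bs] block_path_blocks(3)[OF bs]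
        by (auto simp: R_def max_sum_def)
      then show ?thesis by blast
    qed
  qed
  show "\<exists>vs\<in>?A. R vs abs" if "abs \<in> ?B" for abs
  proof -
    obtain a bs where abs1: "abs = (a, bs)" by (cases abs)
    then have abs: "abs = (a, bs)" "a < n" "bs \<in> block_lists" "max_sum bs = n - 1 - a"
      using that by auto
    show ?thesis
    proof (cases "bs = []")
      case True
      then have "descent a 0 \<in> ?A" "R (descent a 0) abs"
        using abs by (auto simp: canonical_cycles_iff max_sum_def R_def)
      then show ?thesis by blast
    next
      case False
      have 0: "0 \<notin> \<Union>(set bs)" using abs(3) by (auto simp: block_lists_def)
      then obtain vs where vs: "block_path 0 (Max (hd bs)) vs bs"
        using block_path_of_blocks[OF abs(3) False, of 0] by auto
      define d where "d = Max (hd bs)"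
      note vs = vs[folded d_def]
      note w = block_path_walk[OF vs] and b = block_path_blocks[OF vs] and k = block_path_keys[OF vs]
      have "d \<notin> snd ` set vs" using b(1) k(2) by auto
      then have "set (descent a d) \<inter> set vs = {}" by force
      then have "descent a d @ vs \<in> ?A"
        using w abs(2,4) by (auto simp: canonical_cycles_iff successively_append_iff
            successively_Cons max_sum_def)
      moreover have "R (descent a d @ vs) abs" using vs by (auto simp: R_def abs(1))
      ultimately show ?thesis by blast
    qed
  qed
  show "abs = abs'" if "R vs abs" "R vs abs'" for vs abs abs'
    using that by (cases abs; cases abs')
      (auto simp: R_def dest: block_path_walk(1) block_path_functional)
  show "vs = vs'" if RR: "R vs abs" "R vs' abs" for vs vs' abs
  proof -
    obtain a bs where abs: "abs = (a, bs)" by (cases abs)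
    show ?thesis
    proof (cases "bs = []")
      case True
      then show ?thesis using RR block_path_blocks(2) unfolding R_def abs by blast
    next
      case False
      then obtain d w d' w' where *: "block_path 0 d w bs" "vs = descent a d @ w"
        "block_path 0 d' w' bs" "vs' = descent a d' @ w'"
        using RR by (auto simp: R_def abs)
      then show ?thesis
        using block_path_injective[OF *(1,3)] block_path_blocks(4)[OF *(1)]
          block_path_blocks(4)[OF *(3)] by simp
    qed
  qed
qed

text \<open>Here the walk leads from the largest key \<open>m\<close> back to \<open>m\<close>.
  Listing the block that contains \<open>m\<close> first turns a cyclic arrangement of blocks into a
  linear one.\<close>

lemma ex_bij_cycles_avoiding_zero:
  "\<exists>f. bij_betw f {vs \<in> canonical_cycles n. last vs \<noteq> (0, 0)}
     {bs \<in> block_lists. bs \<noteq> [] \<and> (\<forall>B \<in> set bs. Max B \<le> Max (hd bs)) \<and> max_sum bs = n}"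
proof (rule ex_bij_betw_of_relation)
  define R where "R = (\<lambda>vs bs. block_path (Max (hd bs)) (Max (hd bs)) vs bs)"
  let ?A = "{vs \<in> canonical_cycles n. last vs \<noteq> (0, 0)}"
  let ?B = "{bs \<in> block_lists. bs \<noteq> [] \<and> (\<forall>B \<in> set bs. Max B \<le> Max (hd bs)) \<and> max_sum bs = n}"
  show "\<exists>bs\<in>?B. R vs bs" if "vs \<in> ?A" for vs
  proof -
    define m where "m = snd (last vs)"
    have vs: "vs \<noteq> []" "length vs = n" "distinct vs" "successively step vs" "last vs = (0, m)"
        "0 < m" and can: "\<And>e. (0, e) \<in> set vs \<Longrightarrow> 0 < e \<and> e \<le> m"
      using that by (auto simp: canonical_cycles_iff m_def prod_eq_iff)
    have wrap: "step (0, m) (hd vs)"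
      using that vs(5) by (auto simp: canonical_cycles_iff)
    have keys: "\<forall>e \<in> snd ` set vs. 0 < e \<and> e \<le> m"
      using key_in_set[OF vs(4)] can vs(5) by force
    have "\<exists>bs. block_path m m vs bs"
      using vs wrap keys by (intro block_path_of_walk) (auto simp: successively_Cons)
    then obtain bs where bs: "block_path m m vs bs" by blast
    note w = block_path_walk[OF bs] and b = block_path_blocks[OF bs] and k = block_path_keys[OF bs]
    have "Max B \<le> m" if "B \<in> set bs" for B
    proof -
      have "Max B \<in> B" using b(3) that by (auto simp: block_lists_def)
      then have "Max B = m \<or> Max B \<in> snd ` set vs" using that unfolding k(2) by blast
      then show ?thesis using keys by auto
    qed
    then have "bs \<in> ?B" "R vs bs"
      using b w(5) vs(2) bs by (auto simp: R_def max_sum_def)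
    then show ?thesis by blast
  qed
  show "\<exists>vs\<in>?A. R vs bs" if "bs \<in> ?B" for bs
  proof -
    define m where "m = Max (hd bs)"
    have bs: "bs \<in> block_lists" "bs \<noteq> []" "\<And>B. B \<in> set bs \<Longrightarrow> Max B \<le> m" "max_sum bs = n"
      using that by (auto simp: m_def)
    obtain vs where vs: "block_path m m vs bs"
      using block_path_of_blocks[OF bs(1,2), of m] by (auto simp: m_def)
    note w = block_path_walk[OF vs] and b = block_path_blocks[OF vs] and k = block_path_keys[OF vs]
    have "0 < e \<and> e \<le> m" if "e \<in> snd ` set vs" for e
    proof (cases "e = m")
      case False
      then have "e \<in> \<Union>(set bs)" using that unfolding k(2) by blast
      then obtain B where B: "B \<in> set bs" "e \<in> B" by blast
      then have "finite B" "0 \<notin> B" using bs(1) by (auto simp: block_lists_def)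
      then show ?thesis using B bs(3)[OF B(1)] Max_ge[of B e] by (metis gr0I le_trans)
    qed (use b(1) in simp)
    then have "vs \<in> ?A"
      using w bs(4) b(1) by (force simp: canonical_cycles_iff successively_Cons max_sum_def)
    then show ?thesis using vs unfolding R_def m_def by blast
  qed
  show "bs = bs'" if RR: "R vs bs" "R vs bs'" for vs bs bs'
  proof -
    have "Max (hd bs) = Max (hd bs')"
      using RR block_path_walk(2) unfolding R_def by (metis prod.inject)
    then show ?thesis using RR block_path_functional unfolding R_def by metis
  qed
  show "vs = vs'" if "R vs bs" "R vs' bs" for vs vs' bs
    using that block_path_injective unfolding R_def by metis
qed

section \<open>Counting families of blocks\<close>

text \<open>The lower bound \<open>k\<close> serves the shift: lowering all elements by 1 takes
  families above \<open>Suc k\<close> to families above \<open>k\<close>.\<close>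

definition packings :: "nat \<Rightarrow> nat set set set" where
  "packings k = {P. finite P \<and> disjoint P \<and> (\<forall>B\<in>P. finite B \<and> B \<noteq> {} \<and> B \<subseteq> {k<..})}"

definition packings_of :: "nat \<Rightarrow> nat \<Rightarrow> nat \<Rightarrow> nat set set set" where
  "packings_of k t n = {P \<in> packings k. card P = t \<and> sum Max P = n}"

lemma packings_Max_in: "P \<in> packings k \<Longrightarrow> B \<in> P \<Longrightarrow> Max B \<in> B"
  by (auto simp: packings_def)

lemma packings_disjoint:
  "P \<in> packings k \<Longrightarrow> B \<in> P \<Longrightarrow> C \<in> P \<Longrightarrow> B \<noteq> C \<Longrightarrow> B \<inter> C = {}"
  unfolding packings_def disjoint_def by blast

lemma insert_packings_iff:
  assumes "B \<notin> P"
  shows "insert B P \<in> packings k \<longleftrightarrow>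
    P \<in> packings k \<and> finite B \<and> B \<noteq> {} \<and> B \<subseteq> {k<..} \<and> (\<forall>C\<in>P. B \<inter> C = {})"
  using assms unfolding packings_def by (auto simp: pairwise_insert disjnt_def)

lemma subset_packings: "P \<in> packings k \<Longrightarrow> Q \<subseteq> P \<Longrightarrow> Q \<in> packings k"
  unfolding packings_def using finite_subset pairwise_subset by (auto, blast+)

lemma packings_subset_Pow:
  assumes "P \<in> packings k" "sum Max P = n"
  shows "P \<subseteq> Pow {..n}"
proof
  fix B assume B: "B \<in> P"
  have fin: "finite P" "finite B" using assms(1) B by (auto simp: packings_def)
  have "Max B \<le> sum Max P" using fin B by (intro member_le_sum) auto
  then have "x \<le> n" if "x \<in> B" for x
    using Max_ge[OF fin(2) that] assms(2) by linarith
  then show "B \<in> Pow {..n}" by auto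
qed

lemma finite_packings_sum: "finite {P \<in> packings k. sum Max P = n}"
  by (rule finite_subset[of _ "Pow (Pow {..n})"]) (use packings_subset_Pow in blast, simp)

lemma finite_packings_of: "finite (packings_of k t n)"
  by (rule finite_subset[OF _ finite_packings_sum[of k n]]) (auto simp: packings_of_def)

lemma card_le_sum_Max:
  assumes "P \<in> packings k"
  shows "card P \<le> sum Max P"
proof -
  have "Max B \<ge> 1" if "B \<in> P" for B
    using packings_Max_in[OF assms that] assms that unfolding packings_def by fastforce
  then have "(\<Sum>B\<in>P. 1) \<le> sum Max P" by (intro sum_mono) auto
  then show ?thesis by simp
qed

lemma packings_of_less: "n < t \<Longrightarrow> packings_of k t n = {}"
  using card_le_sum_Max by (force simp: packings_of_def)

lemma packings_of_0: "packings_of k 0 n = (if n = 0 then {{}} else {})"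
  by (auto simp: packings_of_def packings_def)

section \<open>A recursion from shifting and removing the element 1\<close>

lemma Suc_image_packings:
  assumes "P \<in> packings k"
  shows "image Suc ` P \<in> packings (Suc k)" "sum Max (image Suc ` P) = sum Max P + card P"
proof -
  have inj: "inj_on (image Suc) P" by (meson inj_Suc inj_image_eq_iff inj_onI)
  show "image Suc ` P \<in> packings (Suc k)"
  proof -
    have "Suc ` B \<inter> Suc ` C = {}" if "B \<in> P" "C \<in> P" "Suc ` B \<noteq> Suc ` C" for B C
      using packings_disjoint[OF assms that(1,2)] that(3) by blast
    then have "disjoint (image Suc ` P)" by (auto simp: disjoint_def)
    moreover have "\<forall>B\<in>P. finite B \<and> B \<noteq> {} \<and> B \<subseteq> {k<..}" "finite P"
      using assms by (auto simp: packings_def)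
    then have "\<forall>B\<in>image Suc ` P. finite B \<and> B \<noteq> {} \<and> B \<subseteq> {Suc k<..}" "finite (image Suc ` P)"
      by auto
    ultimately show ?thesis by (simp add: packings_def)
  qed
  have "Max (Suc ` B) = Suc (Max B)" if "B \<in> P" for B
    using assms that by (intro mono_Max_commute[symmetric]) (auto simp: packings_def mono_def)
  then show "sum Max (image Suc ` P) = sum Max P + card P"
    by (subst sum.reindex[OF inj]) (simp add: sum_Suc)
qed

lemma packings_Suc_eq: "packings (Suc k) = image (image Suc) ` packings k"
proof
  show "image (image Suc) ` packings k \<subseteq> packings (Suc k)"
    using Suc_image_packings(1) by blast
  show "packings (Suc k) \<subseteq> image (image Suc) ` packings k"
  proof
    fix Q assume Q: "Q \<in> packings (Suc k)"
    define P where "P = image (\<lambda>x. x - 1) ` Q"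
    have Q': "finite Q" "\<And>B. B \<in> Q \<Longrightarrow> finite B \<and> B \<noteq> {} \<and> B \<subseteq> {Suc k<..}"
      using Q by (auto simp: packings_def)
    have id: "Suc ` (\<lambda>x. x - 1) ` B = B" if "B \<in> Q" for B
    proof -
      have "Suc (x - 1) = x" if "x \<in> B" for x using Q'(2)[OF \<open>B \<in> Q\<close>] that by auto
      then show ?thesis unfolding image_image by (metis (no_types, lifting) image_cong image_ident)
    qed
    have "image Suc ` P = (\<lambda>B. Suc ` (\<lambda>x. x - 1) ` B) ` Q"
      unfolding P_def image_image ..
    also have "\<dots> = Q" using id by (metis (no_types, lifting) image_cong image_ident)
    finally have QP: "image Suc ` P = Q" .
    have sub: "Suc ` B \<in> Q" if "B \<in> P" for B using that QP by blast
    have "P \<in> packings k"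
      unfolding packings_def mem_Collect_eq
    proof (intro conjI ballI)
      show "finite P" using Q'(1) by (simp add: P_def)
      fix B assume "B \<in> P"
      note B = Q'(2)[OF sub[OF this]]
      show "finite B" using B finite_imageD[of Suc B] by simp
      show "B \<noteq> {}" using B by simp
      show "B \<subseteq> {k<..}" using B by auto
    next
      show "disjoint P"
        unfolding disjoint_def
      proof (intro ballI impI)
        fix B C assume BC: "B \<in> P" "C \<in> P" "B \<noteq> C"
        then have "Suc ` B \<inter> Suc ` C = {}"
          using packings_disjoint[OF Q sub sub] by (simp add: inj_image_eq_iff)
        then show "B \<inter> C = {}" by blast
      qed
    qed
    then show "Q \<in> image (image Suc) ` packings k" using QP by blast
  qed
qed

text \<open>Raising every element by 1 raises each of the \<open>t\<close> maxima by 1, hence their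
  sum by \<open>t\<close>.\<close>

lemma card_packings_of_Suc: "card (packings_of (Suc k) t (n + t)) = card (packings_of k t n)"
proof -
  have inj: "inj (image (image Suc))" by (simp add: inj_image_eq_iff inj_def)
  have "card (image Suc ` P) = card P" for P :: "nat set set"
    by (rule card_image) (meson inj_Suc inj_image_eq_iff inj_onI)
  then have "packings_of (Suc k) t (n + t) = image (image Suc) ` packings_of k t n"
    unfolding packings_of_def packings_Suc_eq using Suc_image_packings(2) by auto
  then show ?thesis using card_image[OF inj_on_subset[OF inj]] by auto
qed

lemma packings_mono: "packings (Suc k) \<subseteq> packings k"
  unfolding packings_def by fastforce

lemma packings_avoid: "packings (Suc k) = {P \<in> packings k. Suc k \<notin> \<Union>P}"
proof -
  have "{Suc k<..} = {k<..} - {Suc k}" by auto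
  then have *: "B \<subseteq> {Suc k<..} \<longleftrightarrow> B \<subseteq> {k<..} \<and> Suc k \<notin> B" for B by blast
  have "(\<forall>B\<in>P. finite B \<and> B \<noteq> {} \<and> B \<subseteq> {k<..} \<and> Suc k \<notin> B) \<longleftrightarrow>
      (\<forall>B\<in>P. finite B \<and> B \<noteq> {} \<and> B \<subseteq> {k<..}) \<and> Suc k \<notin> \<Union>P" for P
    by blast
  then show ?thesis
    unfolding packings_def * mem_Collect_eq by (simp only: conj_assoc)
qed

text \<open>The element 1 is unused, extends one of the \<open>t + 1\<close> other blocks (and leaves its maximum
  unchanged), or is a block of its own.\<close>

lemma card_packings_of_split:
  "card (packings_of 0 (Suc t) (Suc n)) =
     (t + 2) * card (packings_of 1 (Suc t) (Suc n)) + card (packings_of 1 t n)"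
proof -
  let ?A = "packings_of 1 (Suc t) (Suc n)"
  define join where "join = (\<lambda>(P, B). insert (insert (1::nat) B) (P - {B}))"
  let ?B = "insert {1} ` packings_of 1 t n"
  let ?C = "join ` (SIGMA P:?A. P)"
  have one: "1 \<notin> \<Union>P" if "P \<in> packings 1" for P
    using that unfolding One_nat_def packings_avoid[of 0] by blast
  have sing: "insert {1} P \<in> packings_of 0 (Suc t) (Suc n)" if "P \<in> packings_of 1 t n" for P
  proof -
    have P: "P \<in> packings 1" "card P = t" "sum Max P = n" "finite P"
      using that by (auto simp: packings_of_def packings_def)
    have "{1} \<notin> P" using one[OF P(1)] by blast
    then show ?thesis
      using P one[OF P(1)] packings_mono[of 0] by (auto simp: packings_of_def insert_packings_iff)
  qed
  \<comment> \<open>The block through 1 in \<open>join (P, B)\<close> gives back \<open>B\<close>,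
    and the other blocks give back \<open>P - {B}\<close>, so \<open>join\<close> is injective. As
    \<open>B\<close> is nonempty, the block through 1 is not \<open>{1}\<close>, which separates
    \<open>?C\<close> from \<open>?B\<close>.\<close>
  have join_props: "join (P, B) \<in> packings_of 0 (Suc t) (Suc n)"
    "{C \<in> join (P, B). 1 \<in> C} = {insert 1 B}" "join (P, B) - {insert 1 B} = P - {B}" "1 \<notin> B" "B \<noteq> {}"
    if "P \<in> ?A" "B \<in> P" for P B
  proof -
    have P: "P \<in> packings 1" "card P = Suc t" "sum Max P = Suc n" "finite P"
      using that by (auto simp: packings_of_def packings_def)
    show o: "1 \<notin> B" using one[OF P(1)] that(2) by blast
    have B: "finite B" "B \<noteq> {}" "B \<subseteq> {1<..}" using P(1) that(2) by (auto simp: packings_def)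
    then show "B \<noteq> {}" by simp
    have n: "insert 1 B \<notin> P - {B}" using one[OF P(1)] by blast
    have "P - {B} \<in> packings 0"
      using subset_packings[OF P(1), of "P - {B}"] packings_mono[of 0] by auto
    moreover have "insert 1 B \<inter> C = {}" if "C \<in> P - {B}" for C
      using packings_disjoint[OF P(1) \<open>B \<in> P\<close>, of C] that one[OF P(1)] by auto
    moreover have "insert 1 B \<subseteq> {0<..}" using B(3) by auto
    ultimately have "join (P, B) \<in> packings 0"
      unfolding join_def prod.case insert_packings_iff[OF n] using B by blast
    moreover have "card (join (P, B)) = Suc t"
      using n P(2,4) that(2) by (simp add: join_def card_Suc_Diff1)
    moreover have "Max B \<ge> 1" using B Max_in[of B] by fastforce
    then have "Max (insert 1 B) = Max B" using B by (simp add: max_def)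
    then have "sum Max (join (P, B)) = Suc n"
      using n P(3,4) that(2) sum.remove[of P B Max] by (simp add: join_def del: Max_insert)
    ultimately show "join (P, B) \<in> packings_of 0 (Suc t) (Suc n)" by (simp add: packings_of_def)
    show "{C \<in> join (P, B). 1 \<in> C} = {insert 1 B}"
      using one[OF P(1)] by (auto simp: join_def)
    show "join (P, B) - {insert 1 B} = P - {B}" using n by (auto simp: join_def)
  qed
  have eq: "packings_of 0 (Suc t) (Suc n) = ?A \<union> ?B \<union> ?C"
  proof
    have "?A \<subseteq> packings_of 0 (Suc t) (Suc n)"
      using packings_mono[of 0] by (auto simp: packings_of_def)
    then show "?A \<union> ?B \<union> ?C \<subseteq> packings_of 0 (Suc t) (Suc n)"
      using sing join_props(1) by auto
    show "packings_of 0 (Suc t) (Suc n) \<subseteq> ?A \<union> ?B \<union> ?C"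
    proof
      fix Q assume Q': "Q \<in> packings_of 0 (Suc t) (Suc n)"
      then have Q: "Q \<in> packings 0" "card Q = Suc t" "sum Max Q = Suc n" "finite Q"
        by (auto simp: packings_of_def packings_def)
      show "Q \<in> ?A \<union> ?B \<union> ?C"
      proof (cases "1 \<in> \<Union>Q")
        case False
        then have "Q \<in> packings 1" using Q(1) packings_avoid[of 0] by simp
        then show ?thesis using Q by (simp add: packings_of_def)
      next
        case True
        then obtain D where D: "D \<in> Q" "1 \<in> D" by blast
        have other: "1 \<notin> C" if "C \<in> Q" "C \<noteq> D" for C
          using packings_disjoint[OF Q(1) D(1) that(1)] that(2) D(2) by blast
        have rest: "Q - {D} \<in> packings 1"
          unfolding One_nat_def packings_avoid[of 0]
          using subset_packings[OF Q(1), of "Q - {D}"] other by auto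
        have Df: "finite D" "D \<subseteq> {0<..}" using Q(1) D(1) by (auto simp: packings_def)
        have card: "card (Q - {D}) = t" and sum: "Max D + sum Max (Q - {D}) = Suc n"
          using Q D sum.remove[of Q D Max] by auto
        show ?thesis
        proof (cases "D = {1}")
          case True
          then have "Q - {D} \<in> packings_of 1 t n"
            using rest card sum by (simp add: packings_of_def)
          moreover have "Q = insert {1} (Q - {D})" using D True by blast
          ultimately show ?thesis by blast
        next
          case False
          define B where "B = D - {1}"
          have B: "finite B" "B \<noteq> {}" "B \<subseteq> {1<..}" "D = insert 1 B"
            using Df D(2) False by (auto simp: B_def)
          have "B \<inter> C = {}" if "C \<in> Q - {D}" for C
            using packings_disjoint[OF Q(1) D(1), of C] that by (auto simp: B_def)
          moreover from this have n: "B \<notin> Q - {D}" using B(2) by blast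
          ultimately have "insert B (Q - {D}) \<in> packings 1"
            unfolding insert_packings_iff[OF n] using rest B by blast
          moreover have "Max B \<ge> 1" using B Max_in[of B] by fastforce
          then have "Max D = Max B" using B by (simp add: max_def)
          ultimately have "insert B (Q - {D}) \<in> ?A"
            using n Q(4) card sum by (simp add: packings_of_def)
          moreover have "Q = join (insert B (Q - {D}), B)"
            using n D(1) B(4) by (auto simp: join_def)
          ultimately show ?thesis by blast
        qed
      qed
    qed
  qed
  have "inj_on (insert {1}) (packings_of 1 t n)"
  proof (rule inj_onI)
    fix P Q assume PQ: "P \<in> packings_of 1 t n" "Q \<in> packings_of 1 t n" "insert {1} P = insert {1} Q"
    then have "{1} \<notin> P" "{1} \<notin> Q" using one by (auto simp: packings_of_def)
    then show "P = Q" using PQ(3) by (metis insert_ident)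
  qed
  then have cB: "card ?B = card (packings_of 1 t n)" by (rule card_image)
  have "inj_on join (SIGMA P:?A. P)"
  proof (rule inj_onI, clarify)
    fix P B Q C assume PB: "P \<in> ?A" "B \<in> P" and QC: "Q \<in> ?A" "C \<in> Q"
      and e: "join (P, B) = join (Q, C)"
    have "insert 1 B = insert 1 C"
      using join_props(2)[OF PB] join_props(2)[OF QC] e by simp
    then have BC: "B = C" using join_props(4)[OF PB] join_props(4)[OF QC] by (metis insert_ident)
    then have "P - {B} = Q - {B}"
      using join_props(3)[OF PB] join_props(3)[OF QC] e by simp
    then show "P = Q \<and> B = C" using PB(2) QC(2) BC by blast
  qed
  then have "card ?C = card (SIGMA P:?A. P)" by (rule card_image)
  also have "\<dots> = (\<Sum>P\<in>?A. card P)"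
    by (intro card_SigmaI finite_packings_of) (auto simp: packings_of_def packings_def)
  also have "\<dots> = Suc t * card ?A" by (simp add: packings_of_def)
  finally have cC: "card ?C = Suc t * card ?A" .
  have AB: "?A \<inter> ?B = {}" using one by (fastforce simp: packings_of_def)
  have "Q \<notin> ?A \<union> ?B" if Q: "Q \<in> ?C" for Q
  proof -
    obtain P B where PB: "Q = join (P, B)" "P \<in> ?A" "B \<in> P" using Q by auto
    have *: "{C \<in> Q. 1 \<in> C} = {insert 1 B}" "insert 1 B \<noteq> {1}"
      using join_props(2,4,5)[OF PB(2,3)] PB(1) by auto
    then have "1 \<in> \<Union>Q" by blast
    then have "Q \<notin> ?A" using one by (auto simp: packings_of_def)
    moreover have "Q \<notin> ?B"
    proof
      assume "Q \<in> ?B"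
      then have "{1} \<in> {C \<in> Q. 1 \<in> C}" by auto
      then show False unfolding *(1) using *(2) by simp
    qed
    ultimately show ?thesis by blast
  qed
  then have "(?A \<union> ?B) \<inter> ?C = {}" by blast
  moreover have fin: "finite ?A" "finite ?B" "finite ?C"
    using finite_packings_of[of 0 "Suc t" "Suc n"] unfolding eq by auto
  ultimately have "card (packings_of 0 (Suc t) (Suc n)) = card ?A + card ?B + card ?C"
    unfolding eq using AB by (simp add: card_Un_disjoint)
  \<comment> \<open>Leaving 1 out counts \<open>?A\<close> once and extending a block counts it
    \<open>t + 1\<close> times; together this is the factor \<open>t + 2\<close>.\<close>
  then show ?thesis unfolding cB cC by simp
qed

definition packing_number :: "nat \<Rightarrow> nat \<Rightarrow> nat" where
  "packing_number t n = card (packings_of 0 t n)"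

text \<open>After the element 1 is split off, the families lie above 1 and are shifted down. The
  shift takes \<open>t + 1\<close> off the sum of maxima in the first term; in the second it takes
  off \<open>t\<close>, and the removed block \<open>{1}\<close> accounts for the remaining
  1.\<close>

lemma packing_number_rec:
  "packing_number (Suc t) (n + Suc t) = (t + 2) * packing_number (Suc t) n + packing_number t n"
  using card_packings_of_split[of t "n + t"] card_packings_of_Suc[of 0 "Suc t" n]
    card_packings_of_Suc[of 0 t n]
  by (simp add: packing_number_def)

section \<open>From packings to the number of patterns\<close>

lemma block_lists_iff_packing: "bs \<in> block_lists \<longleftrightarrow> distinct bs \<and> set bs \<in> packings 0"
proof -
  have "0 \<notin> B \<longleftrightarrow> B \<subseteq> {0<..}" for B :: "nat set" using gr0I by fastforce
  then show ?thesis by (simp add: block_lists_def packings_def)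
qed

lemma max_sum_eq: "distinct bs \<Longrightarrow> max_sum bs = sum Max (set bs)"
  by (simp add: max_sum_def sum_list_distinct_conv_sum_set)

lemma sum_packings_by_card:
  fixes h :: "nat \<Rightarrow> nat"
  shows "(\<Sum>P | P \<in> packings 0 \<and> sum Max P = n. h (card P)) = (\<Sum>t\<le>n. h t * packing_number t n)"
proof -
  let ?S = "{P \<in> packings 0. sum Max P = n}"
  have "(\<Sum>P\<in>?S. h (card P)) = (\<Sum>t\<le>n. \<Sum>P\<in>{P \<in> ?S. card P = t}. h (card P))"
    by (intro sum.group[symmetric] finite_packings_sum) (use card_le_sum_Max in auto)
  also have "\<dots> = (\<Sum>t\<le>n. h t * packing_number t n)"
  proof (rule sum.cong)
    fix t
    have "{P \<in> ?S. card P = t} = packings_of 0 t n" by (auto simp: packings_of_def)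
    then show "(\<Sum>P\<in>{P \<in> ?S. card P = t}. h (card P)) = h t * packing_number t n"
      by (simp add: packing_number_def packings_of_def)
  qed simp
  finally show ?thesis .
qed

lemma block_lists_sum:
  "finite {bs \<in> block_lists. max_sum bs = n}"
  "card {bs \<in> block_lists. max_sum bs = n} = (\<Sum>t\<le>n. fact t * packing_number t n)"
proof -
  let ?S = "{P \<in> packings 0. sum Max P = n}"
  have eq: "{bs \<in> block_lists. max_sum bs = n} = (\<Union>P\<in>?S. permutations_of_set P)"
    by (auto simp: block_lists_iff_packing max_sum_eq permutations_of_set_def)
  have fin: "finite P" if "P \<in> ?S" for P using that by (simp add: packings_def)
  show "finite {bs \<in> block_lists. max_sum bs = n}"
    unfolding eq using finite_packings_sum by auto
  have "card (\<Union>P\<in>?S. permutations_of_set P) = (\<Sum>P\<in>?S. card (permutations_of_set P))"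
  proof (rule card_UN_disjoint)
    show "\<forall>P\<in>?S. \<forall>Q\<in>?S. P \<noteq> Q \<longrightarrow> permutations_of_set P \<inter> permutations_of_set Q = {}"
      by (auto simp: permutations_of_set_def)
  qed (use fin in \<open>auto intro: finite_packings_sum\<close>)
  also have "\<dots> = (\<Sum>P\<in>?S. fact (card P))" using fin by simp
  also have "\<dots> = (\<Sum>t\<le>n. fact t * packing_number t n)" by (rule sum_packings_by_card)
  finally show "card {bs \<in> block_lists. max_sum bs = n} = (\<Sum>t\<le>n. fact t * packing_number t n)"
    unfolding eq .
qed

text \<open>Disjoint blocks have different maxima, so the head is the unique block with the largest
  one, and the others follow in any order.\<close>

lemma card_permutations_with_max_head:
  assumes "P \<in> packings 0" "P \<noteq> {}"
  shows "card {bs \<in> permutations_of_set P. \<forall>B\<in>P. Max B \<le> Max (hd bs)} = fact (card P - 1)"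
proof -
  have fin: "finite P" using assms by (simp add: packings_def)
  have "Max (Max ` P) \<in> Max ` P" using fin assms(2) by (intro Max_in) auto
  then obtain C where C: "C \<in> P" "Max C = Max (Max ` P)" by (metis imageE)
  have le: "Max B \<le> Max C" if "B \<in> P" for B using C(2) fin that by simp
  have uniq: "B = C" if "B \<in> P" "Max C \<le> Max B" for B
  proof (rule ccontr)
    assume "B \<noteq> C"
    then have "B \<inter> C = {}" using packings_disjoint[OF assms(1) that(1) C(1)] by simp
    moreover have "Max B = Max C" using that le by (simp add: le_antisym)
    ultimately show False
      using packings_Max_in[OF assms(1) that(1)] packings_Max_in[OF assms(1) C(1)] by auto
  qed
  have "{bs \<in> permutations_of_set P. \<forall>B\<in>P. Max B \<le> Max (hd bs)} =
      (#) C ` permutations_of_set (P - {C})"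
  proof (intro equalityI subsetI)
    fix bs assume "bs \<in> {bs \<in> permutations_of_set P. \<forall>B\<in>P. Max B \<le> Max (hd bs)}"
    then have bs: "set bs = P" "distinct bs" "Max C \<le> Max (hd bs)"
      using C(1) by (auto simp: permutations_of_set_def)
    then obtain B cs where cs: "bs = B # cs" using assms(2) by (cases bs) auto
    then have "B = C" using uniq[of B] bs by auto
    moreover have "cs \<in> permutations_of_set (P - {B})"
      using bs cs by (auto simp: permutations_of_set_def)
    ultimately show "bs \<in> (#) C ` permutations_of_set (P - {C})" using cs by blast
  next
    fix bs assume "bs \<in> (#) C ` permutations_of_set (P - {C})"
    then show "bs \<in> {bs \<in> permutations_of_set P. \<forall>B\<in>P. Max B \<le> Max (hd bs)}"
      using C(1) le by (auto simp: permutations_of_set_def)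
  qed
  then show ?thesis using fin C(1) by (simp add: card_image inj_on_def)
qed

lemma block_lists_max_head_sum:
  "card {bs \<in> block_lists. bs \<noteq> [] \<and> (\<forall>B \<in> set bs. Max B \<le> Max (hd bs)) \<and> max_sum bs = n} =
     (\<Sum>t<n. fact t * packing_number (Suc t) n)"
proof -
  let ?S = "{P \<in> packings 0. sum Max P = n}"
  let ?H = "\<lambda>P. {bs \<in> permutations_of_set P. P \<noteq> {} \<and> (\<forall>B\<in>P. Max B \<le> Max (hd bs))}"
  \<comment> \<open>The empty family admits no head and must count 0, whereas
    \<open>fact (t - 1)\<close> would give 1 at \<open>t = 0\<close>.\<close>
  define h :: "nat \<Rightarrow> nat" where "h = (\<lambda>t. if t = 0 then 0 else fact (t - 1))"
  have eq: "{bs \<in> block_lists. bs \<noteq> [] \<and> (\<forall>B \<in> set bs. Max B \<le> Max (hd bs)) \<and> max_sum bs = n} =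
      (\<Union>P\<in>?S. ?H P)"
    by (auto simp: block_lists_iff_packing max_sum_eq permutations_of_set_def)
  have "card (?H P) = h (card P)" if "P \<in> ?S" for P
    using card_permutations_with_max_head[of P] that
    by (cases "P = {}") (auto simp: h_def packings_def)
  moreover have "card (\<Union>P\<in>?S. ?H P) = (\<Sum>P\<in>?S. card (?H P))"
  proof (rule card_UN_disjoint)
    show "\<forall>P\<in>?S. finite (?H P)"
      by (auto simp: packings_def intro: finite_subset[OF _ finite_permutations_of_set])
    show "\<forall>P\<in>?S. \<forall>Q\<in>?S. P \<noteq> Q \<longrightarrow> ?H P \<inter> ?H Q = {}"
      by (auto simp: permutations_of_set_def)
  qed (rule finite_packings_sum)
  ultimately have "card (\<Union>P\<in>?S. ?H P) = (\<Sum>P\<in>?S. h (card P))" by simp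
  also have "\<dots> = (\<Sum>t\<le>n. h t * packing_number t n)" by (rule sum_packings_by_card)
  also have "\<dots> = (\<Sum>t<n. fact t * packing_number (Suc t) n)"
    by (simp only: lessThan_Suc_atMost[symmetric] sum.lessThan_Suc_shift) (simp add: h_def)
  finally show ?thesis unfolding eq .
qed

lemma packing_number_0: "packing_number 0 n = (if n = 0 then 1 else 0)"
  by (simp add: packing_number_def packings_of_0)

lemma packing_number_less: "n < t \<Longrightarrow> packing_number t n = 0"
  by (simp add: packing_number_def packings_of_less)

text \<open>Cycles through the key 0 give the sums over \<open>m < n\<close>, cycles that avoid it
  the terms at \<open>n\<close> itself. The empty block list, which belongs only to the key 0, is
  split off so that all other terms are indexed by \<open>Suc t\<close>.\<close>

lemma num_multiplex_primes_count:
  "num_multiplex_primes n = (\<Sum>m<n. packing_number 0 m) +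
    (\<Sum>t<n. fact (Suc t) * (\<Sum>m<n. packing_number (Suc t) m) + fact t * packing_number (Suc t) n)"
proof -
  let ?A = "{vs \<in> canonical_cycles n. last vs = (0, 0)}"
  let ?B = "{vs \<in> canonical_cycles n. last vs \<noteq> (0, 0)}"
  let ?S = "\<lambda>a. {bs \<in> block_lists. max_sum bs = n - 1 - a}"
  let ?T = "{bs \<in> block_lists. bs \<noteq> [] \<and> (\<forall>B \<in> set bs. Max B \<le> Max (hd bs)) \<and> max_sum bs = n}"
  obtain f g where f: "bij_betw f ?A (SIGMA a:{..<n}. ?S a)" and g: "bij_betw g ?B ?T"
    using ex_bij_cycles_through_zero ex_bij_cycles_avoiding_zero by blast
  have finS: "finite (?S a)" for a by (rule block_lists_sum(1))
  have "?T \<subseteq> {bs \<in> block_lists. max_sum bs = n}" by blast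
  then have "finite ?T" using block_lists_sum(1) by (rule finite_subset)
  then have fin: "finite ?A" "finite ?B"
    using bij_betw_finite[OF f] bij_betw_finite[OF g] finS by auto
  have "card ?A = card (SIGMA a:{..<n}. ?S a)" using f by (rule bij_betw_same_card)
  also have "\<dots> = (\<Sum>a<n. card (?S a))" using finS by (intro card_SigmaI) auto
  also have "\<dots> = (\<Sum>m<n. card {bs \<in> block_lists. max_sum bs = m})"
    using sum.nat_diff_reindex[of "\<lambda>m. card {bs \<in> block_lists. max_sum bs = m}" n] by simp
  \<comment> \<open>Since \<open>packing_number t m\<close> vanishes for \<open>m < t\<close>, the
    range of \<open>t\<close> can be made independent of \<open>m\<close>, as the exchange of the
    sums requires.\<close>
  also have "\<dots> = (\<Sum>m<n. \<Sum>t<Suc n. fact t * packing_number t m)"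
  proof (rule sum.cong)
    fix m assume "m \<in> {..<n}"
    then show "card {bs \<in> block_lists. max_sum bs = m} = (\<Sum>t<Suc n. fact t * packing_number t m)"
      unfolding block_lists_sum(2)
      by (intro sum.mono_neutral_left) (auto simp: packing_number_less)
  qed simp
  also have "\<dots> = (\<Sum>t<Suc n. fact t * (\<Sum>m<n. packing_number t m))"
    by (subst sum.swap) (simp only: sum_distrib_left)
  also have "\<dots> = (\<Sum>m<n. packing_number 0 m) + (\<Sum>t<n. fact (Suc t) * (\<Sum>m<n. packing_number (Suc t) m))"
    by (simp only: sum.lessThan_Suc_shift fact_0 mult_1)
  finally have A: "card ?A = \<dots>" .
  have "card ?B = card ?T" using g by (rule bij_betw_same_card)
  then have B: "card ?B = (\<Sum>t<n. fact t * packing_number (Suc t) n)"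
    by (simp only: block_lists_max_head_sum)
  have "canonical_cycles n = ?A \<union> ?B" by blast
  then have "card (canonical_cycles n) = card ?A + card ?B"
    using card_Un_disjoint[OF fin] by (metis (mono_tags, lifting) disjoint_iff mem_Collect_eq)
  then show ?thesis
    unfolding num_multiplex_primes_eq A B by (simp only: sum.distrib add.assoc)
qed

section \<open>Asymptotics\<close>

text \<open>The limit is the solution of \<open>l = c * l + Y\<close>, and the distance to it
  shrinks by the factor \<open>c\<close> every \<open>p\<close> indices, up to the error of
  \<open>y\<close>. The bound \<open>K\<close> supplies the initial distance, and eventual bounds
  handle all residues modulo \<open>p\<close> at once.\<close>

lemma tendsto_of_delayed_contraction:
  fixes x y :: "nat \<Rightarrow> real"
  assumes rec: "\<And>n. x (n + p) = c * x n + y n"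
    and c: "0 \<le> c" "c < 1" and y: "y \<longlonglongrightarrow> Y" and K: "\<And>n. \<bar>x n\<bar> \<le> K"
  shows "x \<longlonglongrightarrow> Y / (1 - c)"
proof (rule LIMSEQ_I)
  fix \<epsilon> :: real assume \<epsilon>: "\<epsilon> > 0"
  define l where "l = Y / (1 - c)"
  have l: "l = c * l + Y" using c by (simp add: l_def field_simps)
  define M where "M = K + \<bar>l\<bar>"
  have M: "\<bar>x n - l\<bar> \<le> M" for n using K[of n] by (simp add: M_def)
  \<comment> \<open>This tolerance makes the recursion preserve the slack, as \<open>c * (\<epsilon>
    / 2) + (1 - c) * (\<epsilon> / 2) = \<epsilon> / 2\<close>.\<close>
  have y': "eventually (\<lambda>n. \<bar>y n - Y\<bar> < (1 - c) * (\<epsilon> / 2)) sequentially"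
    using tendstoD[OF y, of "(1 - c) * (\<epsilon> / 2)"] c \<epsilon> by (simp add: dist_real_def)
  have ev: "eventually (\<lambda>n. \<bar>x n - l\<bar> \<le> c ^ j * M + \<epsilon> / 2) sequentially" for j
  proof (induction j)
    case 0
    have "\<bar>x n - l\<bar> \<le> M + \<epsilon> / 2" for n using M[of n] \<epsilon> by linarith
    then show ?case by simp
  next
    case (Suc j)
    have "eventually (\<lambda>n. \<bar>x (n + p) - l\<bar> \<le> c ^ Suc j * M + \<epsilon> / 2) sequentially"
      using Suc y'
    proof eventually_elim
      case (elim n)
      have "x (n + p) - l = c * (x n - l) + (y n - Y)"
        by (subst l) (simp add: rec algebra_simps)
      then have "\<bar>x (n + p) - l\<bar> \<le> c * \<bar>x n - l\<bar> + \<bar>y n - Y\<bar>"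
        using c(1) by (metis abs_mult abs_of_nonneg abs_triangle_ineq)
      also have "\<dots> \<le> c * (c ^ j * M + \<epsilon> / 2) + (1 - c) * (\<epsilon> / 2)"
        using elim c(1) by (intro add_mono mult_left_mono) auto
      also have "\<dots> = c ^ Suc j * M + \<epsilon> / 2" by (simp add: field_simps)
      finally show ?case .
    qed
    then show ?case
      using eventually_sequentially_seg[of "\<lambda>n. \<bar>x n - l\<bar> \<le> c ^ Suc j * M + \<epsilon> / 2" p] by blast
  qed
  have "(\<lambda>j. c ^ j * M) \<longlonglongrightarrow> 0"
    using LIMSEQ_power_zero[of c] c by (intro tendsto_mult_left_zero) auto
  then have "eventually (\<lambda>j. c ^ j * M < \<epsilon> / 2) sequentially"
    using \<epsilon> by (intro order_tendstoD(2)) auto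
  then obtain j where j: "c ^ j * M < \<epsilon> / 2"
    using eventually_happens[of _ sequentially] by auto
  from ev[of j] have "eventually (\<lambda>n. \<bar>x n - l\<bar> < \<epsilon>) sequentially"
    by eventually_elim (use j in linarith)
  then show "\<exists>n0. \<forall>n\<ge>n0. norm (x n - Y / (1 - c)) < \<epsilon>"
    by (simp add: eventually_sequentially l_def)
qed

section \<open>The limit constants \<open>q_seq t / fact (t - 1)\<close> and the convergence of the
  series\<close>

definition packing_limit :: "nat \<Rightarrow> real" where
  "packing_limit t = 1 / 2 * (\<Prod>i = 2..t. 1 / (2 ^ i - real i - 1))"

lemma power_two_gt: "2 \<le> i \<Longrightarrow> real i + 1 < 2 ^ i"
  by (induction i rule: nat_induct_at_least) auto

lemma packing_limit_1 [simp]: "packing_limit (Suc 0) = 1 / 2"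
  by (simp add: packing_limit_def)

lemma packing_limit_Suc:
  "packing_limit (Suc (Suc t)) = packing_limit (Suc t) / (2 ^ Suc (Suc t) - real (Suc (Suc t)) - 1)"
  by (simp add: packing_limit_def)

lemma packing_limit_pos: "0 < packing_limit t"
  unfolding packing_limit_def
  by (intro mult_pos_pos prod_pos) (use power_two_gt in \<open>auto simp: algebra_simps\<close>)

lemma q_seq_eq: "q_seq (Suc t) = fact t * packing_limit (Suc t)"
proof -
  have "(\<Prod>i = 2..Suc t. real i - 1) = fact t"
  proof (induction t)
    case (Suc t)
    then show ?case by (simp add: prod.nat_ivl_Suc')
  qed simp
  then show ?thesis
    by (simp add: q_seq_def packing_limit_def prod_dividef)
qed

lemma q_seq_pos: "0 < q_seq (Suc t)"
  by (simp add: q_seq_eq packing_limit_pos)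

lemma summable_gamma_M: "summable (\<lambda>t. (real (Suc t) + 1) * q_seq (Suc t))"
proof (rule summable_ratio_test)
  show "norm ((real (Suc (Suc t)) + 1) * q_seq (Suc (Suc t))) \<le>
      3 / 4 * norm ((real (Suc t) + 1) * q_seq (Suc t))" if "2 \<le> t" for t
  proof -
    \<comment> \<open>This is \<open>3 * (t + 2) \<le> 2 * D\<close> for the denominator
      \<open>D\<close> below, cleared of subtractions. It fails at \<open>t = 1\<close>, hence the
      ratio test starts at 2.\<close>
    have "5 * real t + 12 \<le> 2 ^ (t + 3)"
      using that by (induction t rule: nat_induct_at_least) (auto simp: power_add)
    then have p: "3 * (real t + 2) \<le> 2 * (2 ^ Suc (Suc t) - real (Suc (Suc t)) - 1)"
      by (simp add: power_add)
    define D where "D = 2 ^ Suc (Suc t) - real (Suc (Suc t)) - 1"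
    have D: "0 < D" using power_two_gt[of "Suc (Suc t)"] by (simp add: D_def)
    have q: "q_seq (Suc (Suc t)) = q_seq (Suc t) * (real t + 1) / D"
      by (simp add: q_seq_eq packing_limit_Suc D_def)
    have "(real t + 3) * (real t + 1) \<le> (real t + 2) * (real t + 2)"
      by (simp add: algebra_simps)
    also have "\<dots> \<le> 3 / 4 * (real t + 2) * D"
    proof -
      have "real t + 2 \<le> 3 / 4 * D" using p[folded D_def] D by argo
      then have "(real t + 2) * (real t + 2) \<le> (real t + 2) * (3 / 4 * D)"
        by (intro mult_left_mono) auto
      then show ?thesis by (simp only: mult_ac)
    qed
    finally have "(real t + 3) * (real t + 1) / D \<le> 3 / 4 * (real t + 2)"
      using D by (simp add: field_simps)
    then have "q_seq (Suc t) * ((real t + 3) * (real t + 1) / D) \<le> q_seq (Suc t) * (3 / 4 * (real t + 2))"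
      using q_seq_pos[of t] by (intro mult_left_mono) auto
    moreover have "(real (Suc (Suc t)) + 1) * q_seq (Suc (Suc t)) =
        q_seq (Suc t) * ((real t + 3) * (real t + 1) / D)"
      unfolding q by (simp add: algebra_simps)
    moreover have "3 / 4 * ((real (Suc t) + 1) * q_seq (Suc t)) = q_seq (Suc t) * (3 / 4 * (real t + 2))"
      by (simp add: algebra_simps)
    ultimately have "(real (Suc (Suc t)) + 1) * q_seq (Suc (Suc t)) \<le> 3 / 4 * ((real (Suc t) + 1) * q_seq (Suc t))"
      by (simp only:)
    then show ?thesis
      using q_seq_pos[of t] q_seq_pos[of "Suc t"] by simp
  qed
qed simp

lemma gamma_M_pos: "0 < gamma_M"
  unfolding gamma_M_def
  by (intro suminf_pos summable_gamma_M mult_pos_pos q_seq_pos) auto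

section \<open>Densities relative to \<open>2 ^ n\<close> and their limits\<close>

definition packing_density :: "nat \<Rightarrow> nat \<Rightarrow> real" where
  "packing_density t n = real (packing_number t n) / 2 ^ n"

definition cumulative_density :: "nat \<Rightarrow> nat \<Rightarrow> real" where
  "cumulative_density t n = real (\<Sum>m<n. packing_number t m) / 2 ^ n"

lemma packing_density_rec: "packing_density (Suc t) (n + Suc t) = (real t + 2) / 2 ^ Suc t * packing_density (Suc t) n + packing_density t n / 2 ^ Suc t"
  unfolding packing_density_def packing_number_rec by (simp add: power_add field_simps)

lemma packing_density_0: "packing_density 0 n = (if n = 0 then 1 else 0)"
  by (simp add: packing_density_def packing_number_0)

text \<open>A single block with maximum \<open>Suc n\<close> is \<open>Suc n\<close> together with
  any subset of \<open>{1..n}\<close>, so there are \<open>2 ^ n\<close> of them. This exact value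
  starts the inductions on \<open>t\<close>.\<close>

lemma packing_density_1: "packing_density (Suc 0) (Suc n) = 1 / 2"
proof (induction n)
  case 0
  show ?case using packing_density_rec[of 0 0] by (simp add: packing_density_0) (simp add: packing_density_def packing_number_less)
next
  case (Suc n)
  then show ?case using packing_density_rec[of 0 "Suc n"] by (simp add: packing_density_0)
qed

lemma cumulative_density_Suc: "cumulative_density t (Suc n) = 1 / 2 * cumulative_density t n + 1 / 2 * packing_density t n"
  by (simp add: cumulative_density_def packing_density_def field_simps)

text \<open>The limits solve the stationary form of \<open>packing_density_rec\<close>. With
  \<open>c = (t + 3) / 2 ^ (t + 2)\<close> the denominator \<open>D\<close> is
  \<open>2 ^ (t + 2) * (1 - c)\<close>.\<close>

lemma packing_limit_fixpoint:
  "(real (Suc t) + 2) / 2 ^ Suc (Suc t) * packing_limit (Suc (Suc t)) +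
     packing_limit (Suc t) / 2 ^ Suc (Suc t) = packing_limit (Suc (Suc t))"
proof -
  define D where "D = 2 ^ Suc (Suc t) - real (Suc (Suc t)) - 1"
  have D: "0 < D" using power_two_gt[of "Suc (Suc t)"] by (simp add: D_def)
  have P: "packing_limit (Suc t) = packing_limit (Suc (Suc t)) * D"
    using D packing_limit_Suc[of t, folded D_def] by simp
  have K: "(2::real) ^ Suc (Suc t) = real (Suc t) + 2 + D" by (simp add: D_def)
  have "(k / (k + D)) * x + x * D / (k + D) = x" if "0 \<le> k" for k x :: real
    using D that by (simp add: divide_simps) (simp add: algebra_simps)
  from this[of "real (Suc t) + 2"] show ?thesis unfolding P K by simp
qed

lemma packing_density_nonneg: "0 \<le> packing_density t n" and cumulative_density_nonneg: "0 \<le> cumulative_density t n"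
  by (simp_all add: packing_density_def cumulative_density_def sum_nonneg)

text \<open>The recursion has nonnegative coefficients and the limits satisfy it with equality, so
  the bound passes on to larger \<open>n\<close>, starting from small \<open>n\<close> where the
  density is 0. A bound uniform in \<open>n\<close> is what dominated summation needs later.\<close>

lemma packing_density_le: "packing_density (Suc t) n \<le> packing_limit (Suc t)"
proof (induction t arbitrary: n)
  case 0
  show ?case
  proof (cases n)
    case (Suc m)
    then show ?thesis using packing_density_1[of m] by simp
  qed (simp add: packing_density_def packing_number_less)
next
  case (Suc t)
  show ?case
  proof (induction n rule: less_induct)
    case (less n)
    show ?case
    proof (cases "n < Suc (Suc t)")
      case True
      then show ?thesis using packing_limit_pos[of "Suc (Suc t)"] by (simp add: packing_density_def packing_number_less)
    next
      case False
      then obtain m where n: "n = m + Suc (Suc t)" by (metis add.commute le_Suc_ex not_less)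
      have "packing_density (Suc (Suc t)) n = (real (Suc t) + 2) / 2 ^ Suc (Suc t) * packing_density (Suc (Suc t)) m
          + packing_density (Suc t) m / 2 ^ Suc (Suc t)"
        unfolding n by (rule packing_density_rec)
      also have "\<dots> \<le> (real (Suc t) + 2) / 2 ^ Suc (Suc t) * packing_limit (Suc (Suc t)) +
          packing_limit (Suc t) / 2 ^ Suc (Suc t)"
        using less[of m] Suc.IH[of m] by (intro add_mono mult_left_mono divide_right_mono) (auto simp: n)
      finally show ?thesis unfolding packing_limit_fixpoint .
    qed
  qed
qed

text \<open>Each new value is the mean of two quantities bounded by the same constant.\<close>

lemma cumulative_density_le: "cumulative_density (Suc t) n \<le> packing_limit (Suc t)"
proof (induction n)
  case 0
  show ?case using packing_limit_pos[of "Suc t"] by (simp add: cumulative_density_def)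
next
  case (Suc n)
  then show ?case using packing_density_le[of t n] by (simp add: cumulative_density_Suc)
qed

text \<open>By induction the density with one block fewer converges, so it acts as a convergent
  inhomogeneity in the contraction lemma; the coefficient \<open>c\<close> is below 1 by
  \<open>power_two_gt\<close>.\<close>

lemma packing_density_tendsto: "packing_density (Suc t) \<longlonglongrightarrow> packing_limit (Suc t)"
proof (induction t)
  case 0
  have "(\<lambda>n. packing_density (Suc 0) (Suc n)) \<longlonglongrightarrow> 1 / 2" by (simp add: packing_density_1)
  then show ?case by (subst (asm) filterlim_sequentially_Suc) simp
next
  case (Suc t)
  define c where "c = (real (Suc t) + 2) / 2 ^ Suc (Suc t)"
  have c: "0 \<le> c" "c < 1"
    using power_two_gt[of "Suc (Suc t)"] by (simp_all add: c_def)
  have "packing_density (Suc (Suc t)) \<longlonglongrightarrow> packing_limit (Suc t) / 2 ^ Suc (Suc t) / (1 - c)"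
  proof (rule tendsto_of_delayed_contraction)
    show "packing_density (Suc (Suc t)) (n + Suc (Suc t)) = c * packing_density (Suc (Suc t)) n + packing_density (Suc t) n / 2 ^ Suc (Suc t)" for n
      unfolding c_def by (rule packing_density_rec)
    show "\<bar>packing_density (Suc (Suc t)) n\<bar> \<le> packing_limit (Suc (Suc t))" for n
      using packing_density_le[of "Suc t" n] packing_density_nonneg[of "Suc (Suc t)" n] by simp
    show "(\<lambda>n. packing_density (Suc t) n / 2 ^ Suc (Suc t)) \<longlonglongrightarrow> packing_limit (Suc t) / 2 ^ Suc (Suc t)"
      by (intro tendsto_divide Suc tendsto_const) simp
  qed (use c in auto)
  moreover have "packing_limit (Suc t) / 2 ^ Suc (Suc t) = (1 - c) * packing_limit (Suc (Suc t))"
    using packing_limit_fixpoint[of t] unfolding c_def by (simp add: algebra_simps)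
  ultimately show ?case using c(2) by (simp only:) simp
qed

text \<open>The contraction lemma applies with delay 1 and \<open>c = 1 / 2\<close>. The earlier
  densities enter with geometric weights of total 1, so the limit is unchanged.\<close>

lemma cumulative_density_tendsto: "cumulative_density (Suc t) \<longlonglongrightarrow> packing_limit (Suc t)"
proof -
  have "cumulative_density (Suc t) \<longlonglongrightarrow> (1 / 2 * packing_limit (Suc t)) / (1 - 1 / 2)"
  proof (rule tendsto_of_delayed_contraction[where p = 1])
    show "\<bar>cumulative_density (Suc t) n\<bar> \<le> packing_limit (Suc t)" for n
      using cumulative_density_le[of t n] cumulative_density_nonneg[of "Suc t" n] by simp
    show "(\<lambda>n. 1 / 2 * packing_density (Suc t) n) \<longlonglongrightarrow> 1 / 2 * packing_limit (Suc t)"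
      by (intro tendsto_mult packing_density_tendsto tendsto_const)
  qed (simp_all add: cumulative_density_Suc)
  then show ?thesis by simp
qed

lemma cumulative_density_0_tendsto: "cumulative_density 0 \<longlonglongrightarrow> 0"
proof -
  have "cumulative_density 0 (Suc n) = (1 / 2) ^ Suc n" for n
    by (simp add: cumulative_density_def packing_number_0 power_divide)
  moreover have "(\<lambda>n. (1 / 2 :: real) ^ Suc n) \<longlonglongrightarrow> 0"
    by (intro LIMSEQ_Suc LIMSEQ_power_zero) simp
  ultimately have "(\<lambda>n. cumulative_density 0 (Suc n)) \<longlonglongrightarrow> 0" by (simp only:)
  then show ?thesis by (subst (asm) filterlim_sequentially_Suc)
qed

theorem theorem3p6:
  shows "summable (\<lambda>t. (real (Suc t) + 1) * q_seq (Suc t)) \<and>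
    (\<lambda>n. real (num_multiplex_primes n)) \<sim>[at_top] (\<lambda>n. gamma_M * 2 ^ n)"
proof -
  \<comment> \<open>\<open>a t n\<close> is the contribution of the families of \<open>Suc t\<close>
    blocks, divided by \<open>2 ^ n\<close>. In the limit the factor \<open>t + 2\<close> of
    \<open>q_seq (Suc t)\<close> splits into \<open>t + 1\<close> from cycles through the key 0 and
    1 from the others.\<close>
  define a where "a = (\<lambda>t n. fact (Suc t) * cumulative_density (Suc t) n + fact t * packing_density (Suc t) n)"
  have M: "(real (Suc t) + 1) * q_seq (Suc t) =
      fact (Suc t) * packing_limit (Suc t) + fact t * packing_limit (Suc t)" for t
    by (simp add: q_seq_eq algebra_simps)
  have "((\<lambda>n. \<Sum>t. a t n) \<longlongrightarrow> gamma_M) sequentially"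
    unfolding gamma_M_def
  proof (rule tannerys_theorem[THEN conjunct2, THEN conjunct2])
    show "(a t \<longlongrightarrow> (real (Suc t) + 1) * q_seq (Suc t)) sequentially" for t
      unfolding a_def M by (intro tendsto_intros cumulative_density_tendsto packing_density_tendsto)
    have "norm (a t n) \<le> (real (Suc t) + 1) * q_seq (Suc t)" for t n
      unfolding a_def M using cumulative_density_le[of t n] packing_density_le[of t n]
        cumulative_density_nonneg[of "Suc t" n] packing_density_nonneg[of "Suc t" n]
      by (simp del: fact_Suc add: add_mono mult_left_mono)
    then show "eventually (\<lambda>(t, n). norm (a t n) \<le> (real (Suc t) + 1) * q_seq (Suc t))
        (at_top \<times>\<^sub>F sequentially)"
      by (intro always_eventually) auto
  qed (use summable_gamma_M in auto)
  \<comment> \<open>For fixed \<open>n\<close> the series is finite, since \<open>Suc t\<close>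
    blocks have maxima summing to at least \<open>Suc t\<close>.\<close>
  moreover have "(\<Sum>t. a t n) = (\<Sum>t<n. a t n)" for n
    by (rule suminf_finite) (auto simp: a_def cumulative_density_def packing_density_def packing_number_less)
  ultimately have "(\<lambda>n. cumulative_density 0 n + (\<Sum>t<n. a t n)) \<longlonglongrightarrow> 0 + gamma_M"
    by (intro tendsto_add cumulative_density_0_tendsto) simp
  moreover have "a t n = real (fact (Suc t) * (\<Sum>m<n. packing_number (Suc t) m) +
      fact t * packing_number (Suc t) n) / 2 ^ n" for t n
    by (simp add: a_def cumulative_density_def packing_density_def add_divide_distrib del: fact_Suc)
  then have "cumulative_density 0 n + (\<Sum>t<n. a t n) = real (num_multiplex_primes n) / 2 ^ n" for n
    by (simp only: num_multiplex_primes_count cumulative_density_def of_nat_add[symmetric] add_divide_distrib[symmetric]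
        sum_divide_distrib[symmetric] of_nat_sum[symmetric])
  ultimately have "(\<lambda>n. real (num_multiplex_primes n) / 2 ^ n) \<longlonglongrightarrow> gamma_M" by simp
  \<comment> \<open>The limit of the quotient yields an asymptotic equivalence because
    \<open>gamma_M\<close> is nonzero.\<close>
  then have "(\<lambda>n. real (num_multiplex_primes n)) \<sim>[at_top] (\<lambda>n. gamma_M * 2 ^ n)"
    using gamma_M_pos by (intro asymp_equivI'_const) auto
  then show ?thesis using summable_gamma_M by blast
qed

end
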